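(* Let $(E;\xi,\eta)$ and $(E';\xi',\eta')$ be two triangular elliptic curves and $(\Lambda,\phi)$ and $(\Lambda',\phi')$ the associated parabolic $\mathbb Q$-lattices (so $E=\mathbb C/\Lambda$, $E'=\mathbb C/\Lambda'$). (i) Let $f:(E;\xi,\eta)\to(E';\xi',\eta')$ be an isogeny of triangular elliptic curves. Then $\Lambda\subset\Lambda'$, $f:\mathbb C/\Lambda\to\mathbb C/\Lambda'$ is the map induced by the identity, and $\phi'=f\circ\phi$. (ii) The parabolic $\mathbb Q$-lattices $(\Lambda,\phi)$ and $(\Lambda',\phi')$ are commensurable if and only if there exist two isogenies of triangular elliptic curves $f:(E,\xi,\eta)\to(E'',\xi'',\eta'')$ and $f':(E',\xi',\eta')\to(E'',\xi'',\eta'')$ to the same triangular elliptic curve.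
   Context: For an elliptic curve $E=\mathbb C/\Lambda$, $E_{\rm tor}=\mathbb Q\Lambda/\Lambda$, $TE=\mathrm{Hom}(\mathbb Q/\mathbb Z,E_{\rm tor})$, and a character $\chi\in\mathrm{Hom}(E,\mathbb R/\mathbb Z)$ (continuous homomorphism) gives $T(\chi):TE\to\mathrm{Hom}(\mathbb Q/\mathbb Z,\mathbb Q/\mathbb Z)=\hat{\mathbb Z}$. For $\xi\in TE$, $\xi^\perp=\{\chi\in\mathrm{Hom}(E,\mathbb R/\mathbb Z): T(\chi)(\xi)=0\}$. A triangular structure on $E$ is a pair $(\xi,\eta)$ of elements of $TE$ with $\xi\ne0$ and $\{T(\chi)(\eta):\chi\in\xi^\perp\}=\mathbb Z\subset\hat{\mathbb Z}$; a triangular elliptic curve is an elliptic curve with a triangular structure. An isogeny $f:(E,\xi,\eta)\to(E',\xi',\eta')$ of triangular elliptic curves is an isogeny $f:E\to E'$ (surjective holomorphic homomorphism with finite kernel) with $T(f)(\xi)=\xi'$ and $T(f)(\eta)=\eta'$. A two-dimensional $\mathbb Q$-lattice is a pair $(\Lambda,\phi)$ with $\Lambda\subset\mathbb C$ a lattice and $\phi:\mathbb Q^2/\mathbb Z^2\to\mathbb Q\Lambda/\Lambda$ a homomorphism. Two are commensurable if $\mathbb Q\Lambda_1=\mathbb Q\Lambda_2$ and $\phi_1=\phi_2$ modulo $\Lambda_1+\Lambda_2$. With $e_1=1,e_2=-i$, $\Lambda_0=\mathbb Ze_1+\mathbb Ze_2$, and $2\times2$ matrices acting in the basis $(e_1,e_2)$,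 a parabolic $\mathbb Q$-lattice is one of the form $(\alpha^{-1}\Lambda_0,\alpha^{-1}\circ\rho)$ with $\rho=\begin{pmatrix} u&v\\0&1\end{pmatrix}$, $u,v\in\hat{\mathbb Z}=\mathrm{End}(\mathbb Q/\mathbb Z)$, $\rho(x,y)=(ux+vy)e_1+ye_2$, and $\alpha=\begin{pmatrix} a&b\\0&1\end{pmatrix}$, $a>0$, $b\in\mathbb R$. A triple $(E;\xi,\eta)$ corresponds to a $\mathbb Q$-lattice $(\Lambda,\phi)$, $\phi(x,y)=\xi(x)+\eta(y)$, unique up to the scaling $(\Lambda,\phi)\mapsto(\lambda\Lambda,\lambda\phi)$, $\lambda\in\mathbb C^\times$; for a triangular elliptic curve exactly one $\mathbb Q$-lattice in this scaling class is parabolic, and it is called the associated (parabolic) $\mathbb Q$-lattice. *)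

theory Defs
  imports "HOL-Analysis.Analysis" "HOL-Algebra.Coset"
begin

section \<open>Quotients of additive groups\<close>

definition add_grp :: "'a::ab_group_add set \<Rightarrow> 'a monoid" where
  "add_grp S = \<lparr>carrier = S, monoid.mult = (+), one = 0\<rparr>"

abbreviation coset :: "'a::ab_group_add set \<Rightarrow> 'a \<Rightarrow> 'a set" where
  "coset H z \<equiv> H #>\<^bsub>add_grp UNIV\<^esub> z"

text \<open>Homomorphisms are taken to be extensional (undefined outside the carrier of the source), so
  that equality of homomorphisms is equality in HOL.\<close>

definition Hom :: "('a, 'c) monoid_scheme \<Rightarrow> ('b, 'd) monoid_scheme \<Rightarrow> ('a \<Rightarrow> 'b) set" where
  "Hom G H = hom G H \<inter> extensional (carrier G)"

text \<open>The quotient topology on the group \<open>'a / H\<close>.\<close>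

definition quot_top :: "'a::{ab_group_add, topological_space} set \<Rightarrow> 'a set topology" where
  "quot_top H =
     topology (\<lambda>U. U \<subseteq> carrier (add_grp UNIV Mod H) \<and> open {z. coset H z \<in> U})"

lemma openin_quot_top:
  "openin (quot_top H) U \<longleftrightarrow> U \<subseteq> carrier (add_grp UNIV Mod H) \<and> open {z. coset H z \<in> U}"
proof -
  have "istopology (\<lambda>U. U \<subseteq> carrier (add_grp UNIV Mod H) \<and> open {z. coset H z \<in> U})"
    unfolding istopology_def
  proof (intro conjI allI impI)
    fix S T assume "S \<subseteq> carrier (add_grp UNIV Mod H) \<and> open {z. coset H z \<in> S}"
      and "T \<subseteq> carrier (add_grp UNIV Mod H) \<and> open {z. coset H z \<in> T}"
    then show "open {z. coset H z \<in> S \<inter> T}"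
      by (simp add: open_Collect_conj)
  next
    fix K assume *: "\<forall>U\<in>K. U \<subseteq> carrier (add_grp UNIV Mod H) \<and> open {z. coset H z \<in> U}"
    have "{z. coset H z \<in> \<Union>K} = (\<Union>U\<in>K. {z. coset H z \<in> U})" by blast
    with * show "open {z. coset H z \<in> \<Union>K}" by auto
  qed auto
  then show ?thesis by (simp add: quot_top_def)
qed

section \<open>The groups \<open>\<real>/\<int>\<close>, \<open>\<rat>/\<int>\<close> and the ring of profinite integers\<close>

definition RZ :: "real set monoid" where
  "RZ = add_grp UNIV Mod \<int>"

text \<open>\<open>\<rat>/\<int>\<close> is realised inside \<open>\<real>/\<int>\<close>: its elements are the cosets \<open>r + \<int>\<close> in \<open>\<real>\<close> with \<open>r\<close> rational.\<close>

definition QZ :: "real set monoid" where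
  "QZ = add_grp \<rat> Mod \<int>"

definition Zhat :: "(real set \<Rightarrow> real set) set" where
  "Zhat = Hom QZ QZ"

text \<open>The image of \<open>\<int>\<close> in \<^term>\<open>Zhat\<close>: multiplication by an integer.\<close>

definition int_Zhat :: "(real set \<Rightarrow> real set) set" where
  "int_Zhat = range (\<lambda>n::int. \<lambda>x\<in>carrier QZ. x [^]\<^bsub>QZ\<^esub> n)"

text \<open>\<open>\<rat>\<^sup>2/\<int>\<^sup>2\<close> is identified with \<open>\<rat>/\<int> \<times> \<rat>/\<int>\<close>.\<close>

definition QZ2 :: "(real set \<times> real set) monoid" where
  "QZ2 = QZ \<times>\<times> QZ"

section \<open>Elliptic curves\<close>

definition lattice_in_complex :: "complex set \<Rightarrow> bool" where
  "lattice_in_complex L \<longleftrightarrow>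
     (\<exists>w1 w2. w1 \<noteq> w2 \<and> independent {w1, w2} \<and> L = {of_int m * w1 + of_int n * w2 | m n. True})"

definition rat_mult :: "complex set \<Rightarrow> complex set" where
  "rat_mult L = {q *\<^sub>R z | q z. q \<in> \<rat> \<and> z \<in> L}"

text \<open>An elliptic curve \<open>E = \<complex>/L\<close> is represented by its lattice \<open>L\<close>.\<close>

definition ell :: "complex set \<Rightarrow> complex set monoid" where
  "ell L = add_grp UNIV Mod L"

text \<open>The subgroup \<open>E\<^sub>t\<^sub>o\<^sub>r = \<rat>L/L\<close> of \<^term>\<open>ell L\<close>, and \<open>TE = Hom(\<rat>/\<int>, E\<^sub>t\<^sub>o\<^sub>r)\<close>.\<close>

definition ell_tor :: "complex set \<Rightarrow> complex set monoid" where
  "ell_tor L = add_grp (rat_mult L) Mod L"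

definition TE :: "complex set \<Rightarrow> (real set \<Rightarrow> complex set) set" where
  "TE L = Hom QZ (ell_tor L)"

definition characters :: "complex set \<Rightarrow> (complex set \<Rightarrow> real set) set" where
  "characters L = {\<psi> \<in> Hom (ell L) RZ. continuous_map (quot_top L) (quot_top \<int>) \<psi>}"

text \<open>The functor \<open>T\<close> on morphisms, both for maps between elliptic curves and for characters.
  If \<open>\<psi>\<close> is a character, \<open>\<psi> \<circ> \<xi>\<close> takes values in the torsion subgroup \<open>\<rat>/\<int>\<close> of \<open>\<real>/\<int>\<close>,
  so it is an element of \<^term>\<open>Zhat\<close>.\<close>

definition T_map :: "(complex set \<Rightarrow> 'b) \<Rightarrow> (real set \<Rightarrow> complex set) \<Rightarrow> (real set \<Rightarrow> 'b)" where
  "T_map h \<xi> = compose (carrier QZ) h \<xi>"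

definition perp :: "complex set \<Rightarrow> (real set \<Rightarrow> complex set) \<Rightarrow> (complex set \<Rightarrow> real set) set" where
  "perp L \<xi> = {\<psi> \<in> characters L. T_map \<psi> \<xi> = (\<lambda>x\<in>carrier QZ. \<one>\<^bsub>QZ\<^esub>)}"

text \<open>Holomorphy for the complex structure on \<open>\<complex>/L\<close> and \<open>\<complex>/L'\<close> making the projections from \<open>\<complex>\<close>
  local biholomorphisms: \<open>f\<close> lifts locally to a holomorphic function.\<close>

definition holomorphic_ell :: "complex set \<Rightarrow> complex set \<Rightarrow> (complex set \<Rightarrow> complex set) \<Rightarrow> bool" where
  "holomorphic_ell L L' f \<longleftrightarrow>
     (\<forall>z0. \<exists>U g. open U \<and> z0 \<in> U \<and> g holomorphic_on U \<and>
        (\<forall>z\<in>U. f (coset L z) = coset L' (g z)))"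

definition isogeny :: "complex set \<Rightarrow> complex set \<Rightarrow> (complex set \<Rightarrow> complex set) \<Rightarrow> bool" where
  "isogeny L L' f \<longleftrightarrow>
     f \<in> Hom (ell L) (ell L') \<and> holomorphic_ell L L' f \<and>
     f ` carrier (ell L) = carrier (ell L') \<and> finite (kernel (ell L) (ell L') f)"

section \<open>Triangular elliptic curves\<close>

type_synonym marked_ell =
  "complex set \<times> (real set \<Rightarrow> complex set) \<times> (real set \<Rightarrow> complex set)"

fun triangular_ell :: "marked_ell \<Rightarrow> bool" where
  "triangular_ell (L, \<xi>, \<eta>) \<longleftrightarrow>
     lattice_in_complex L \<and> \<xi> \<in> TE L \<and> \<eta> \<in> TE L \<and>
     \<xi> \<noteq> (\<lambda>x\<in>carrier QZ. \<one>\<^bsub>ell_tor L\<^esub>) \<and>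
     {T_map \<psi> \<eta> | \<psi>. \<psi> \<in> perp L \<xi>} = int_Zhat"

fun triangular_isogeny :: "marked_ell \<Rightarrow> marked_ell \<Rightarrow> (complex set \<Rightarrow> complex set) \<Rightarrow> bool" where
  "triangular_isogeny (L, \<xi>, \<eta>) (L', \<xi>', \<eta>') f \<longleftrightarrow>
     isogeny L L' f \<and> T_map f \<xi> = \<xi>' \<and> T_map f \<eta> = \<eta>'"

section \<open>Two-dimensional \<open>\<rat>\<close>-lattices\<close>

type_synonym qlat = "complex set \<times> (real set \<times> real set \<Rightarrow> complex set)"

fun Q_lattice :: "qlat \<Rightarrow> bool" where
  "Q_lattice (\<Lambda>, \<phi>) \<longleftrightarrow> lattice_in_complex \<Lambda> \<and> \<phi> \<in> Hom QZ2 (ell_tor \<Lambda>)"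

text \<open>The map \<open>\<complex>/L \<rightarrow> \<complex>/L'\<close> induced by the identity of \<open>\<complex>\<close>. When \<open>L \<subseteq> L'\<close>, the union has only
  one distinct member: a coset \<open>z + L\<close> is sent to \<open>z + L'\<close>.\<close>

definition induced_id :: "complex set \<Rightarrow> complex set \<Rightarrow> complex set \<Rightarrow> complex set" where
  "induced_id L L' = (\<lambda>X\<in>carrier (ell L). \<Union>z\<in>X. coset L' z)"

fun commensurable :: "qlat \<Rightarrow> qlat \<Rightarrow> bool" where
  "commensurable (\<Lambda>\<^sub>1, \<phi>\<^sub>1) (\<Lambda>\<^sub>2, \<phi>\<^sub>2) \<longleftrightarrow>
     rat_mult \<Lambda>\<^sub>1 = rat_mult \<Lambda>\<^sub>2 \<and>
     (let S = {x + y | x y. x \<in> \<Lambda>\<^sub>1 \<and> y \<in> \<Lambda>\<^sub>2} in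
       \<forall>p\<in>carrier QZ2. induced_id \<Lambda>\<^sub>1 S (\<phi>\<^sub>1 p) = induced_id \<Lambda>\<^sub>2 S (\<phi>\<^sub>2 p))"

definition e1 :: complex where "e1 = 1"
definition e2 :: complex where "e2 = - \<i>"

definition Lambda0 :: "complex set" where
  "Lambda0 = {of_int m * e1 + of_int n * e2 | m n. True}"

text \<open>The matrix \<open>(a b; 0 1)\<close> acting on column vectors of coordinates in the basis \<open>(e1, e2)\<close>;
  the coordinates of \<open>z\<close> are \<open>(Re z, - Im z)\<close>.\<close>

definition alpha :: "real \<Rightarrow> real \<Rightarrow> complex \<Rightarrow> complex" where
  "alpha a b z = of_real (a * Re z + b * (- Im z)) * e1 + of_real (- Im z) * e2"

text \<open>\<open>\<rho>(x, y) = (u x + v y) e1 + y e2\<close>. As \<open>r\<close> and \<open>t\<close> run over two cosets of \<open>\<int>\<close> in \<open>\<real>\<close>,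
  \<open>r e1 + t e2\<close> runs over exactly one coset of \<open>\<Lambda>\<^sub>0\<close> in \<open>\<complex>\<close>.\<close>

definition rho :: "(real set \<Rightarrow> real set) \<Rightarrow> (real set \<Rightarrow> real set) \<Rightarrow> real set \<times> real set \<Rightarrow> complex set"
  where "rho u v = (\<lambda>(x, y). {of_real r * e1 + of_real t * e2 | r t. r \<in> u x \<otimes>\<^bsub>QZ\<^esub> v y \<and> t \<in> y})"

fun parabolic :: "qlat \<Rightarrow> bool" where
  "parabolic (\<Lambda>, \<phi>) \<longleftrightarrow> Q_lattice (\<Lambda>, \<phi>) \<and>
     (\<exists>a b u v. a > 0 \<and> u \<in> Zhat \<and> v \<in> Zhat \<and>
        \<Lambda> = inv_into UNIV (alpha a b) ` Lambda0 \<and>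
        \<phi> = (\<lambda>p\<in>carrier QZ2. inv_into UNIV (alpha a b) ` rho u v p))"

fun scale_qlat :: "complex \<Rightarrow> qlat \<Rightarrow> qlat" where
  "scale_qlat c (\<Lambda>, \<phi>) = ((*) c ` \<Lambda>, \<lambda>p\<in>carrier QZ2. (*) c ` \<phi> p)"

fun qlat_of :: "marked_ell \<Rightarrow> qlat" where
  "qlat_of (L, \<xi>, \<eta>) = (L, \<lambda>(x, y)\<in>carrier QZ2. \<xi> x \<otimes>\<^bsub>ell L\<^esub> \<eta> y)"

text \<open>\<open>P\<close> is the parabolic \<open>\<rat>\<close>-lattice associated to \<open>E\<close>, and multiplication by \<open>c\<close> is the
  identification of \<open>E\<close> with \<open>\<complex>/\<Lambda>\<close>, where \<open>\<Lambda>\<close> is the lattice of \<open>P\<close>.\<close>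

definition associated_parabolic :: "marked_ell \<Rightarrow> complex \<Rightarrow> qlat \<Rightarrow> bool" where
  "associated_parabolic E c P \<longleftrightarrow> c \<noteq> 0 \<and> P = scale_qlat c (qlat_of E) \<and> parabolic P"

text \<open>Given identifications \<open>c : \<complex>/L \<rightarrow> \<complex>/\<Lambda>\<close> and \<open>c' : \<complex>/L' \<rightarrow> \<complex>/\<Lambda>'\<close> by multiplication,
  a map \<open>f : \<complex>/L \<rightarrow> \<complex>/L'\<close> is regarded as the map \<open>c' \<circ> f \<circ> c\<inverse> : \<complex>/\<Lambda> \<rightarrow> \<complex>/\<Lambda>'\<close>.\<close>

definition transport ::
  "complex set \<Rightarrow> complex \<Rightarrow> complex \<Rightarrow> (complex set \<Rightarrow> complex set) \<Rightarrow> complex set \<Rightarrow> complex set" where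
  "transport \<Lambda> c c' f = (\<lambda>X\<in>carrier (ell \<Lambda>). (*) c' ` f ((*) (inverse c) ` X))"

end

theory Submission
  imports Defs
begin

text \<open>
  In the basis \<open>(e\<^sub>1, e\<^sub>2)\<close> a parabolic \<open>\<rat>\<close>-lattice is upper triangular. Its lattice \<open>\<Lambda>\<close> has a real
  generator \<open>1/a\<close>, and taking the second coordinate (minus the imaginary part) maps \<open>\<Lambda>\<close> onto \<open>\<int>\<close>.
  Modulo \<open>\<int>\<close>, the second coordinate of \<open>\<phi>(x, y)\<close> is \<open>y\<close>, and \<open>\<phi>(x, 0) = u x / a\<close> with \<open>u \<noteq> 0\<close> in
  \<open>Hom(\<rat>/\<int>, \<rat>/\<int>)\<close>, a torsion-free group.

  An isogeny lifts to multiplication by a complex number (\<open>isogenyE\<close>). If multiplication by \<open>\<nu>\<close>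
  maps one parabolic lattice into another and respects the markings, then \<open>\<nu> = 1\<close>
  (\<open>parabolic_rigidity\<close>): compatibility with \<open>\<xi>\<close> and torsion-freeness force \<open>\<nu>\<close> to preserve the real
  axis, and compatibility with \<open>\<eta>\<close> forces it to act as \<open>1\<close> on second coordinates. This is the first
  claim.

  If both curves are isogenous to the same triangular curve, the same rigidity, stated with a
  denominator \<open>N\<close>, shows that both isogenies are the identity of \<open>\<complex>\<close> for one and the same scaling of
  the target lattice, \<open>M\<close> say (\<open>common_target_scaling\<close>). So \<open>\<phi>\<close> and \<open>\<phi>'\<close> agree modulo
  \<open>M\<close>. They even agree modulo \<open>\<Lambda> + \<Lambda>'\<close>, because their difference is a homomorphism from a divisible
  group to the finite group \<open>M / (\<Lambda> + \<Lambda>')\<close>.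

  Conversely, commensurable \<open>\<rat>\<close>-lattices project to the same marking of \<open>\<complex> / (\<Lambda> + \<Lambda>')\<close>. The sum is a
  lattice of the same triangular shape (\<open>parabolic_sum_lattice\<close>), and the marking is triangular
  (\<open>triangular_overlattice\<close>): the characters that annihilate \<open>\<xi>\<close> are the integral multiples of the
  second coordinate, and their values on \<open>\<eta>\<close> are the integers.

  The lifting statements for isogenies and for characters both rest on
  \<open>local_lift_extends_linear\<close>.
\<close>

section \<open>Cosets and homomorphisms of quotients of additive groups\<close>

lemma add_grp_simps [simp]:
  "carrier (add_grp S) = S" "x \<otimes>\<^bsub>add_grp S\<^esub> y = x + y" "\<one>\<^bsub>add_grp S\<^esub> = 0"
  by (simp_all add: add_grp_def)

lemma comm_group_add_grp: "comm_group (add_grp (UNIV :: 'a::ab_group_add set))"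
proof (rule comm_groupI)
  fix x :: 'a
  show "\<exists>y\<in>carrier (add_grp UNIV). y \<otimes>\<^bsub>add_grp UNIV\<^esub> x = \<one>\<^bsub>add_grp UNIV\<^esub>"
    by (rule bexI [of _ "- x"]) auto
qed (auto simp: ac_simps)

lemma inv_add_grp [simp]: "inv\<^bsub>add_grp UNIV\<^esub> x = - (x :: 'a::ab_group_add)"
  by (rule group.inv_equality) (auto simp: comm_group_add_grp comm_group.axioms)

abbreviation add_subgroup :: "'a::ab_group_add set \<Rightarrow> bool" where
  "add_subgroup H \<equiv> subgroup H (add_grp UNIV)"

lemma add_subgroupI:
  assumes "0 \<in> H" and "\<And>x y. x \<in> H \<Longrightarrow> y \<in> H \<Longrightarrow> x - y \<in> H"
  shows "add_subgroup H"
proof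
  show inv: "inv\<^bsub>add_grp UNIV\<^esub> x \<in> H" if "x \<in> H" for x
    using assms(2) [OF assms(1) that] by simp
  show "x \<otimes>\<^bsub>add_grp UNIV\<^esub> y \<in> H" if "x \<in> H" "y \<in> H" for x y
    using assms(2) [OF that(1) inv [OF that(2)]] by simp
qed (use assms in auto)

lemma add_subgroup_mem:
  assumes "add_subgroup H"
  shows "0 \<in> H" "x \<in> H \<Longrightarrow> y \<in> H \<Longrightarrow> x + y \<in> H" "x \<in> H \<Longrightarrow> - x \<in> H"
    "x \<in> H \<Longrightarrow> y \<in> H \<Longrightarrow> x - y \<in> H"
proof -
  show *: "0 \<in> H" "x \<in> H \<Longrightarrow> y \<in> H \<Longrightarrow> x + y \<in> H" "x \<in> H \<Longrightarrow> - x \<in> H" for x y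
    using subgroup.one_closed [OF assms] subgroup.m_closed [OF assms, of x y]
      subgroup.m_inv_closed [OF assms, of x] by auto
  show "x \<in> H \<Longrightarrow> y \<in> H \<Longrightarrow> x - y \<in> H"
    using *(2) [of x "- y"] *(3) [of y] by simp
qed

lemma add_subgroup_of_int_mult:
  fixes x :: "'a::comm_ring_1"
  assumes "add_subgroup H" "x \<in> H"
  shows "of_int n * x \<in> H"
proof -
  have nat: "of_nat k * x \<in> H" for k
    by (induction k) (auto simp: algebra_simps assms add_subgroup_mem [OF assms(1)])
  show ?thesis
    using nat [of "nat n"] add_subgroup_mem(3) [OF assms(1) nat [of "nat (- n)"]]
    by (cases "n \<ge> 0") auto
qed

lemma mem_coset: "x \<in> coset H z \<longleftrightarrow> x - z \<in> H"
proof -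
  have "x \<in> coset H z \<longleftrightarrow> (\<exists>h\<in>H. x = h + z)"
    by (auto simp: r_coset_def)
  also have "\<dots> \<longleftrightarrow> x - z \<in> H"
    by (metis add_diff_cancel_right' diff_add_cancel)
  finally show ?thesis .
qed

lemma coset_eq_iff:
  assumes "add_subgroup H"
  shows "coset H z = coset H w \<longleftrightarrow> z - w \<in> H"
proof
  assume "coset H z = coset H w"
  then show "z - w \<in> H"
    using mem_coset [of z H z] mem_coset [of z H w] add_subgroup_mem(1) [OF assms] by simp
next
  assume *: "z - w \<in> H"
  have "x - z \<in> H \<longleftrightarrow> x - w \<in> H" for x
    using add_subgroup_mem(2) [OF assms, of "x - z", OF _ *]
      add_subgroup_mem(4) [OF assms, of "x - w", OF _ *] by auto
  then show "coset H z = coset H w"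
    by (auto simp: mem_coset)
qed

lemma coset_0 [simp]: "coset H 0 = H"
  by (auto simp: mem_coset)

lemma coset_eq_subgroup_iff: "add_subgroup H \<Longrightarrow> coset H z = H \<longleftrightarrow> z \<in> H"
  using coset_eq_iff [of H z 0] by simp

lemma quot_carrier: "carrier (add_grp S Mod H) = coset H ` S"
  by (auto simp: carrier_FactGroup r_coset_def)

lemma quot_mult:
  assumes "add_subgroup H"
  shows "coset H z <#>\<^bsub>add_grp S\<^esub> coset H w = coset H (z + w)"
proof -
  have "x \<in> coset H z <#>\<^bsub>add_grp S\<^esub> coset H w \<longleftrightarrow> x \<in> coset H (z + w)" for x
  proof
    assume "x \<in> coset H z <#>\<^bsub>add_grp S\<^esub> coset H w"
    then obtain p q where pq: "p - z \<in> H" "q - w \<in> H" "x = p + q"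
      unfolding set_mult_def by (auto simp: mem_coset)
    then show "x \<in> coset H (z + w)"
      using add_subgroup_mem(2) [OF assms pq(1,2)] by (simp add: mem_coset algebra_simps)
  next
    assume "x \<in> coset H (z + w)"
    then have "x - w \<in> coset H z" "w \<in> coset H w"
      using add_subgroup_mem(1) [OF assms] by (simp_all add: mem_coset algebra_simps)
    then show "x \<in> coset H z <#>\<^bsub>add_grp S\<^esub> coset H w"
      unfolding set_mult_def by force
  qed
  then show ?thesis by auto
qed

text \<open>Choosing representatives replaces homomorphisms of quotients by functions on numbers that are
  additive up to elements of the target subgroup. Normalising the value at \<open>0\<close> makes the
  restrictions of a \<open>\<rat>\<close>-lattice to the two coordinate axes of \<open>\<rat>\<^sup>2/\<int>\<^sup>2\<close> easy to read off.\<close>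

lemma quot_hom_lift:
  assumes f: "f \<in> hom (add_grp S Mod H) (add_grp S' Mod H')"
    and H: "add_subgroup H" and H': "add_subgroup H'" and S: "add_subgroup S"
    and S': "0 \<in> S'"
  obtains F where "F 0 = 0" "\<And>z. z \<in> S \<Longrightarrow> F z \<in> S' \<and> f (coset H z) = coset H' (F z)"
    "\<And>z w. z \<in> S \<Longrightarrow> w \<in> S \<Longrightarrow> F (z + w) - F z - F w \<in> H'"
proof -
  have "\<exists>y\<in>S'. f (coset H z) = coset H' y" if "z \<in> S" for z
    using hom_carrier [OF f] that by (auto simp: quot_carrier)
  then obtain F0 where F0: "\<And>z. z \<in> S \<Longrightarrow> F0 z \<in> S' \<and> f (coset H z) = coset H' (F0 z)"
    by metis
  have add: "coset H' (F0 (z + w)) = coset H' (F0 z + F0 w)" if "z \<in> S" "w \<in> S" for z w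
  proof -
    have "f (coset H z \<otimes>\<^bsub>add_grp S Mod H\<^esub> coset H w)
        = f (coset H z) \<otimes>\<^bsub>add_grp S' Mod H'\<^esub> f (coset H w)"
      by (rule hom_mult [OF f]) (use that in \<open>auto simp: quot_carrier\<close>)
    then show ?thesis
      using that F0 add_subgroup_mem(2) [OF S] by (simp add: quot_mult H H')
  qed
  have F00: "F0 0 \<in> H'"
    using add [of 0 0] add_subgroup_mem(1) [OF S] add_subgroup_mem(3) [OF H', of "- F0 0"]
    by (simp add: coset_eq_iff H')
  define F where "F = F0(0 := 0)"
  have F: "F z \<in> S' \<and> f (coset H z) = coset H' (F z)" if "z \<in> S" for z
    using F0 [OF that] F00 S' coset_eq_subgroup_iff [OF H'] by (auto simp: F_def)
  show thesis
  proof (rule that)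
    show "F 0 = 0" by (simp add: F_def)
    fix z w assume zw: "z \<in> S" "w \<in> S"
    have "F (z + w) - (F z + F w) \<in> H'"
      using add [OF zw] F F0 zw add_subgroup_mem(2) [OF S zw] quot_mult [OF H', of S']
      by (metis coset_eq_iff [OF H'])
    then show "F (z + w) - F z - F w \<in> H'" by (simp add: algebra_simps)
  qed (use F in auto)
qed

text \<open>For additive \<open>g\<close> with \<open>g ` H \<subseteq> H'\<close> the members of the union coincide, so the union is the value
  of the induced homomorphism without a choice of representatives.\<close>

definition quot_map :: "'a::ab_group_add set \<Rightarrow> 'b::ab_group_add set \<Rightarrow> ('a \<Rightarrow> 'b) \<Rightarrow> 'a set \<Rightarrow> 'b set"
  where "quot_map H H' g = (\<lambda>X\<in>carrier (add_grp UNIV Mod H). \<Union>z\<in>X. coset H' (g z))"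

lemma quot_map_coset:
  assumes H: "add_subgroup H" and H': "add_subgroup H'" and g: "Modules.additive g" "g ` H \<subseteq> H'"
  shows "quot_map H H' g (coset H z) = coset H' (g z)"
proof -
  have "coset H' (g w) = coset H' (g z)" if "w \<in> coset H z" for w
    using that g by (auto simp: coset_eq_iff H' mem_coset simp flip: Modules.additive.diff)
  moreover have "z \<in> coset H z"
    using add_subgroup_mem(1) [OF H] by (simp add: mem_coset)
  ultimately have "(\<Union>w\<in>coset H z. coset H' (g w)) = coset H' (g z)"
    by blast
  then show ?thesis
    by (simp add: quot_map_def quot_carrier)
qed

lemma quot_map_Hom:
  assumes H: "add_subgroup H" and H': "add_subgroup H'" and g: "Modules.additive g" "g ` H \<subseteq> H'"
  shows "quot_map H H' g \<in> Hom (add_grp UNIV Mod H) (add_grp UNIV Mod H')"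
  unfolding Hom_def hom_def
  by (auto simp: quot_carrier quot_mult H H' quot_map_coset [OF assms] Modules.additive.add [OF g(1)])
     (simp add: quot_map_def quot_carrier)

lemma quot_hom_eqI:
  assumes "f \<in> extensional (carrier (add_grp S Mod H))" "g \<in> extensional (carrier (add_grp S Mod H))"
    and "\<And>z. z \<in> S \<Longrightarrow> f (coset H z) = g (coset H z)"
  shows "f = g"
  using assms by (intro extensionalityI [OF assms(1,2)]) (auto simp: quot_carrier)

lemma mult_image_coset:
  fixes c :: "'a::field"
  assumes "c \<noteq> 0"
  shows "(*) c ` coset L z = coset ((*) c ` L) (c * z)"
proof -
  have "x \<in> (*) c ` coset L z \<longleftrightarrow> x \<in> coset ((*) c ` L) (c * z)" for x
  proof -
    have *: "y \<in> (*) c ` M \<longleftrightarrow> y / c \<in> M" for y M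
      using assms by (auto simp: image_iff intro: bexI [of _ "y / c"])
    show ?thesis
      using assms by (simp add: mem_coset * diff_divide_distrib)
  qed
  then show ?thesis by auto
qed

lemma add_subgroup_mult_image:
  fixes c :: "'a::field"
  assumes "add_subgroup L"
  shows "add_subgroup ((*) c ` L)"
  using add_subgroup_mem [OF assms]
  by (intro add_subgroupI) (auto simp: image_iff simp flip: right_diff_distrib)

lemma add_subgroup_Ints: "add_subgroup (\<int> :: real set)"
  and add_subgroup_Rats: "add_subgroup (\<rat> :: real set)"
  by (auto intro: add_subgroupI)

lemma QZ_carrier: "carrier QZ = coset \<int> ` \<rat>"
  by (simp add: QZ_def quot_carrier)

lemma QZ_mult: "coset \<int> r \<otimes>\<^bsub>QZ\<^esub> coset \<int> s = coset \<int> (r + s)"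
  by (simp add: QZ_def quot_mult add_subgroup_Ints)

lemma QZ_one: "\<one>\<^bsub>QZ\<^esub> = coset \<int> 0"
  by (simp add: QZ_def)

lemma QZ_group: "group QZ"
proof (rule groupI)
  fix x assume "x \<in> carrier QZ"
  then obtain r where r: "r \<in> \<rat>" "x = coset \<int> r" by (auto simp: QZ_carrier)
  show "\<exists>y\<in>carrier QZ. y \<otimes>\<^bsub>QZ\<^esub> x = \<one>\<^bsub>QZ\<^esub>"
    by (rule bexI [of _ "coset \<int> (- r)"]) (use r in \<open>auto simp: QZ_carrier QZ_mult QZ_one\<close>)
qed (auto simp: QZ_carrier QZ_one QZ_mult add.assoc simp del: coset_0)

lemma QZ_int_pow:
  assumes "r \<in> \<rat>"
  shows "coset \<int> r [^]\<^bsub>QZ\<^esub> (n::int) = coset \<int> (of_int n * r)"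
proof -
  have nat: "coset \<int> r [^]\<^bsub>QZ\<^esub> (k::nat) = coset \<int> (of_nat k * r)" for k
    by (induction k) (simp_all add: QZ_one QZ_mult algebra_simps del: coset_0)
  have neg: "inv\<^bsub>QZ\<^esub> (coset \<int> s) = coset \<int> (- s)" if "s \<in> \<rat>" for s
    by (rule group.inv_equality [OF QZ_group])
       (use that in \<open>auto simp: QZ_carrier QZ_mult QZ_one\<close>)
  show ?thesis
    by (cases "n \<ge> 0") (use assms in \<open>simp_all add: int_pow_def2 nat neg\<close>)
qed

section \<open>Lifting homomorphisms of quotients to linear maps\<close>

text \<open>Near \<open>0\<close> a small local lift is additive, because its additivity defect is a small element of the
  discrete group \<open>D\<close>; hence \<open>n *\<^sub>R g (z /\<^sub>R n)\<close> does not depend on the large number \<open>n\<close> and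
  defines the linear extension. Boundedness near \<open>0\<close> forces homogeneity.\<close>

lemma local_lift_extends_linear:
  fixes F g :: "'a::real_normed_vector \<Rightarrow> 'b::real_normed_vector"
  assumes D: "add_subgroup D" and discrete: "\<And>d. d \<in> D \<Longrightarrow> norm d < e \<Longrightarrow> d = 0"
    and F: "\<And>z w. F (z + w) - F z - F w \<in> D"
    and r: "r > 0"
    and g: "\<And>z. norm z < r \<Longrightarrow> F z - g z \<in> D" "\<And>z. norm z < r \<Longrightarrow> norm (g z) < e / 3"
  obtains \<kappa> where "linear \<kappa>" "\<And>z. F z - \<kappa> z \<in> D" "\<And>z. norm z < r \<Longrightarrow> \<kappa> z = g z"
proof -
  have g_add: "g (z + w) = g z + g w" if "norm z < r" "norm w < r" "norm (z + w) < r" for z w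
  proof -
    have "(F (z + w) - F z - F w) - (F (z + w) - g (z + w)) + (F z - g z) + (F w - g w) \<in> D"
      by (intro add_subgroup_mem [OF D] F g that)
    then have "g (z + w) - g z - g w \<in> D"
      by (simp add: algebra_simps)
    moreover have "norm (g (z + w) - g z - g w) < e"
      using norm_triangle_ineq4 [of "g (z + w) - g z" "g w"] norm_triangle_ineq4 [of "g (z + w)" "g z"]
        g(2) [OF that(1)] g(2) [OF that(2)] g(2) [OF that(3)] by linarith
    ultimately have "g (z + w) - g z - g w = 0"
      by (rule discrete)
    then show ?thesis
      by (simp add: algebra_simps)
  qed
  have g0: "g 0 = 0"
    using g_add [of 0 0] r by simp
  have g_nat: "g (real k *\<^sub>R z) = real k *\<^sub>R g z" if "norm (real k *\<^sub>R z) < r" for k z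
    using that
  proof (induction k)
    case (Suc k)
    have "norm (real k *\<^sub>R z) \<le> norm (real (Suc k) *\<^sub>R z)" "norm z \<le> norm (real (Suc k) *\<^sub>R z)"
      by (simp_all add: distrib_right)
    with Suc.prems have *: "norm (real k *\<^sub>R z) < r" "norm z < r" by linarith+
    have eq: "real (Suc k) *\<^sub>R z = real k *\<^sub>R z + z" by (simp add: algebra_simps)
    have "g (real (Suc k) *\<^sub>R z) = g (real k *\<^sub>R z) + g z"
      unfolding eq by (rule g_add [OF *]) (use Suc.prems in \<open>simp only: eq\<close>)
    then show ?case
      using Suc.IH [OF *(1)] by (simp add: algebra_simps)
  qed (simp add: g0)
  define N where "N z = nat \<lceil>norm z / r\<rceil> + 1" for z :: 'a
  have N: "norm z < real (N z) * r" "N z > 0" for z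
  proof -
    have "norm z / r < real (N z)"
      unfolding N_def by (simp add: of_nat_nat) linarith
    with r show "norm z < real (N z) * r" by (simp add: field_simps)
  qed (simp add: N_def)
  define \<kappa> where "\<kappa> z = real (N z) *\<^sub>R g (z /\<^sub>R real (N z))" for z
  have small: "norm (z /\<^sub>R real n) < r" if "norm z < real n * r" "n > 0" for n z
    using that by (simp add: field_simps)
  have indep: "real m *\<^sub>R g (z /\<^sub>R real m) = real (m * n) *\<^sub>R g (z /\<^sub>R real (m * n))"
    if "norm z < real m * r" "m > 0" "n > 0" for m n z
  proof -
    have eq: "z /\<^sub>R real m = real n *\<^sub>R (z /\<^sub>R real (m * n))"
      using that by (simp add: field_simps)
    have "norm (z /\<^sub>R real m) < r"
      using that by (intro small)
    then have "g (z /\<^sub>R real m) = real n *\<^sub>R g (z /\<^sub>R real (m * n))"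
      using g_nat [of n "z /\<^sub>R real (m * n)"] unfolding eq by blast
    then show ?thesis by simp
  qed
  have \<kappa>_eq: "\<kappa> z = real n *\<^sub>R g (z /\<^sub>R real n)" if "norm z < real n * r" "n > 0" for n z
    using indep [OF N(1) N(2) that(2), of z] indep [OF that N(2), of z]
    by (simp add: \<kappa>_def mult.commute)
  have \<kappa>_add: "\<kappa> (z + w) = \<kappa> z + \<kappa> w" for z w
  proof -
    define n where "n = N z + N w"
    have n: "n > 0" "norm z < real n * r" "norm w < real n * r" "norm (z + w) < real n * r"
    proof -
      have "real n * r = real (N z) * r + real (N w) * r" by (simp add: n_def algebra_simps)
      moreover have "0 < real (N z) * r" "0 < real (N w) * r" using N(2) r by simp_all
      ultimately show "norm z < real n * r" "norm w < real n * r" "norm (z + w) < real n * r"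
        using N(1) [of z] N(1) [of w] norm_triangle_ineq [of z w] by linarith+
    qed (use N(2) [of z] in \<open>simp add: n_def\<close>)
    have "g (z /\<^sub>R real n + w /\<^sub>R real n) = g (z /\<^sub>R real n) + g (w /\<^sub>R real n)"
      by (rule g_add) (use n small in \<open>simp_all only: scaleR_add_right [symmetric]\<close>)
    then show ?thesis
      using n by (simp add: \<kappa>_eq flip: scaleR_add_right)
  qed
  interpret \<kappa>: Modules.additive \<kappa>
    by unfold_locales (rule \<kappa>_add)
  have \<kappa>_nat: "\<kappa> (real k *\<^sub>R z) = real k *\<^sub>R \<kappa> z" for k z
    by (induction k) (simp_all add: \<kappa>.zero \<kappa>_add scaleR_left_distrib)
  have \<kappa>_int: "\<kappa> (of_int k *\<^sub>R z) = of_int k *\<^sub>R \<kappa> z" for k z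
  proof (cases "k \<ge> 0")
    case True
    then show ?thesis using \<kappa>_nat [of "nat k" z] by simp
  next
    case False
    then show ?thesis using \<kappa>_nat [of "nat (- k)" z] by (simp add: \<kappa>.minus)
  qed
  have bound: "norm (\<kappa> z) \<le> real n * (e / 3)" if "norm z < real n * r" "n > 0" for n z
  proof -
    have "norm (g (z /\<^sub>R real n)) < e / 3"
      by (rule g(2)) (use that in \<open>intro small\<close>)
    then show ?thesis
      using that by (simp add: \<kappa>_eq mult_left_mono less_imp_le)
  qed
  have \<kappa>_scaleR: "\<kappa> (t *\<^sub>R z) = t *\<^sub>R \<kappa> z" for t z
  proof (rule ccontr)
    define x where "x = \<kappa> (t *\<^sub>R z) - t *\<^sub>R \<kappa> z"
    define B where "B = real (N z) * (e / 3) + norm (\<kappa> z)"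
    assume "\<kappa> (t *\<^sub>R z) \<noteq> t *\<^sub>R \<kappa> z"
    then have "norm x > 0" by (simp add: x_def)
    then obtain n where n: "B < real n * norm x"
      using reals_Archimedean3 by blast
    define s where "s = frac (real n * t)"
    have s: "0 \<le> s" "s < 1" by (simp_all add: s_def frac_lt_1)
    have nt: "real n * t = of_int \<lfloor>real n * t\<rfloor> + s" by (simp add: s_def frac_def)
    have "real n *\<^sub>R x = \<kappa> ((real n * t) *\<^sub>R z) - (real n * t) *\<^sub>R \<kappa> z"
      using \<kappa>_nat [of n "t *\<^sub>R z"] by (simp add: x_def scaleR_diff_right)
    also have "\<dots> = \<kappa> (s *\<^sub>R z) - s *\<^sub>R \<kappa> z"
      by (subst (1 2) nt) (simp add: scaleR_left_distrib \<kappa>_add \<kappa>_int)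
    finally have "real n * norm x \<le> norm (\<kappa> (s *\<^sub>R z)) + norm (s *\<^sub>R \<kappa> z)"
      by (metis norm_triangle_ineq4 norm_scaleR abs_of_nat)
    moreover have "norm (\<kappa> (s *\<^sub>R z)) \<le> real (N z) * (e / 3)"
    proof (rule bound)
      have "s * norm z \<le> norm z" using s by (simp add: mult_left_le_one_le)
      then show "norm (s *\<^sub>R z) < real (N z) * r" using N(1) [of z] s by simp
    qed (rule N)
    moreover have "norm (s *\<^sub>R \<kappa> z) \<le> norm (\<kappa> z)"
      using s by (simp add: mult_left_le_one_le)
    ultimately show False using n by (simp add: B_def)
  qed
  have F_nat: "F (real k *\<^sub>R z) - real k *\<^sub>R F z \<in> D" for k z
  proof (induction k)
    case 0
    show ?case using add_subgroup_mem(3) [OF D F [of 0 0]] by simp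
  next
    case (Suc k)
    show ?case
      using add_subgroup_mem(2) [OF D Suc.IH F [of "real k *\<^sub>R z" z]]
      by (simp add: algebra_simps)
  qed
  have D_nat: "real k *\<^sub>R d \<in> D" if "d \<in> D" for k d
    by (induction k)
       (use that in \<open>auto simp: scaleR_left_distrib intro: add_subgroup_mem [OF D]\<close>)
  show thesis
  proof (rule that)
    show "linear \<kappa>" by (rule linearI) (rule \<kappa>_add, rule \<kappa>_scaleR)
    show "\<kappa> z = g z" if "norm z < r" for z
      using \<kappa>_eq [of z 1] that by simp
    fix z
    define y where "y = z /\<^sub>R real (N z)"
    have z: "z = real (N z) *\<^sub>R y" using N(2) [of z] by (simp add: y_def)
    have "norm y < r" unfolding y_def by (intro small N)
    then have "(F (real (N z) *\<^sub>R y) - real (N z) *\<^sub>R F y) + real (N z) *\<^sub>R (F y - g y) \<in> D"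
      by (intro add_subgroup_mem(2) [OF D] F_nat D_nat g)
    then show "F z - \<kappa> z \<in> D"
      using z by (simp add: \<kappa>_def y_def algebra_simps)
  qed
qed

lemma topspace_quot_top: "topspace (quot_top H) = range (coset H)"
proof
  have "openin (quot_top H) (range (coset H))"
    by (simp add: openin_quot_top quot_carrier)
  then show "range (coset H) \<subseteq> topspace (quot_top H)"
    by (rule openin_subset)
  show "topspace (quot_top H) \<subseteq> range (coset H)"
    using openin_topspace [of "quot_top H"] unfolding openin_quot_top quot_carrier by (rule conjunct1)
qed

text \<open>The interval \<open>(-1/4, 1/4)\<close> embeds as an open subset of \<open>\<real>/\<int>\<close>; on its preimage, a neighbourhood
  of \<open>0\<close>, the representatives in the interval are a small local lift.\<close>

lemma character_lift:
  assumes S: "add_subgroup S" and \<psi>: "\<psi> \<in> characters S"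
  obtains \<kappa> where "linear \<kappa>" "\<And>z. \<psi> (coset S z) = coset \<int> (\<kappa> z)"
proof -
  have hom: "\<psi> \<in> hom (add_grp UNIV Mod S) (add_grp UNIV Mod (\<int> :: real set))"
    and cont: "continuous_map (quot_top S) (quot_top \<int>) \<psi>"
    using \<psi> by (auto simp: characters_def Hom_def ell_def RZ_def)
  have UNIV: "add_subgroup (UNIV :: complex set)" by (rule add_subgroupI) auto
  obtain F where F: "F 0 = 0" "\<And>z. \<psi> (coset S z) = coset \<int> (F z)"
    "\<And>z w. F (z + w) - F z - F w \<in> \<int>"
    using quot_hom_lift [OF hom S add_subgroup_Ints UNIV] by auto
  define V :: "real set set" where "V = coset \<int> ` {-1/4<..<1/4}"
  have V: "openin (quot_top \<int>) V"
  proof -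
    have "{t. coset \<int> t \<in> V} = (\<Union>n::int. {of_int n - 1/4<..<of_int n + 1/4})"
    proof (intro equalityI subsetI)
      fix t assume "t \<in> {t. coset \<int> t \<in> V}"
      then obtain s where "s \<in> {-1/4<..<1/4}" "coset \<int> t = coset \<int> s"
        unfolding V_def by blast
      then have s: "\<bar>s\<bar> < 1/4" "t - s \<in> \<int>"
        by (auto simp: coset_eq_iff add_subgroup_Ints)
      then obtain n where "t - s = of_int n" by (auto simp: Ints_def)
      with s show "t \<in> (\<Union>n::int. {of_int n - 1/4<..<of_int n + 1/4})"
        by (auto intro!: exI [of _ n])
    next
      fix t :: real assume "t \<in> (\<Union>n::int. {of_int n - 1/4<..<of_int n + 1/4})"
      then obtain n :: int where "t \<in> {of_int n - 1/4<..<of_int n + 1/4}" by blast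
      then have "t - of_int n \<in> {-1/4<..<1/4}" by auto
      moreover have "coset \<int> t = coset \<int> (t - of_int n)"
        by (simp add: coset_eq_iff add_subgroup_Ints)
      ultimately show "t \<in> {t. coset \<int> t \<in> V}" by (auto simp: V_def)
    qed
    moreover have "open (\<Union>n::int. {of_int n - 1/4<..<of_int n + 1/4 :: real})" by auto
    ultimately show ?thesis
      by (auto simp: openin_quot_top quot_carrier V_def)
  qed
  have "openin (quot_top S) {x \<in> topspace (quot_top S). \<psi> x \<in> V}"
    using cont V by (simp add: continuous_map_def Pi_iff)
  then have "open {z. coset S z \<in> topspace (quot_top S) \<and> coset \<int> (F z) \<in> V}"
    by (simp add: openin_quot_top F)
  then have "open {z. coset \<int> (F z) \<in> V}" by (simp add: topspace_quot_top)
  moreover have "0 \<in> {z. coset \<int> (F z) \<in> V}"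
    by (auto simp: F V_def simp del: coset_0)
  ultimately obtain r where r: "r > 0" "ball 0 r \<subseteq> {z. coset \<int> (F z) \<in> V}"
    using open_contains_ball by blast
  have "\<exists>t. F z - t \<in> \<int> \<and> norm t < 1/3" if "norm z < r" for z
  proof -
    have "coset \<int> (F z) \<in> V" using r that by auto
    then obtain t where "t \<in> {-1/4<..<1/4}" "coset \<int> (F z) = coset \<int> t"
      unfolding V_def by blast
    then have "F z - t \<in> \<int>" "norm t < 1/3"
      by (auto simp: coset_eq_iff add_subgroup_Ints)
    then show ?thesis by blast
  qed
  then obtain g where g: "F z - g z \<in> \<int>" "norm (g z) < 1/3" if "norm z < r" for z
    by metis
  have discrete: "d = 0" if "d \<in> \<int>" "norm d < 1" for d :: real
    using that by (auto simp: Ints_def)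
  obtain \<kappa> where "linear \<kappa>" "\<And>z. F z - \<kappa> z \<in> \<int>"
    by (rule local_lift_extends_linear [where D = \<int> and F = F and g = g and e = 1 and r = r])
       (use add_subgroup_Ints discrete F(3) r(1) g in blast)+
  then show thesis
    using that F(2) by (simp add: coset_eq_iff add_subgroup_Ints)
qed

lemma quot_map_character:
  assumes S: "add_subgroup S" and \<kappa>: "linear \<kappa>" "\<kappa> ` S \<subseteq> \<int>"
  shows "quot_map S \<int> \<kappa> \<in> characters S"
proof -
  have add: "Modules.additive \<kappa>"
    using \<kappa>(1) by (simp add: Modules.additive_def linear_add)
  note coset = quot_map_coset [OF S add_subgroup_Ints add \<kappa>(2)]
  have "continuous_map (quot_top S) (quot_top \<int>) (quot_map S \<int> \<kappa>)"
  proof (unfold continuous_map_def, intro conjI allI impI)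
    fix U :: "real set set" assume "openin (quot_top \<int>) U"
    then have "open {t. coset \<int> t \<in> U}"
      by (simp add: openin_quot_top)
    then have "open (\<kappa> -` {t. coset \<int> t \<in> U})"
      by (rule open_vimage)
         (use \<kappa>(1) in \<open>simp add: linear_continuous_on linear_conv_bounded_linear\<close>)
    moreover have "{z. coset S z \<in> topspace (quot_top S) \<and> quot_map S \<int> \<kappa> (coset S z) \<in> U}
        = \<kappa> -` {t. coset \<int> t \<in> U}"
      by (auto simp: topspace_quot_top coset)
    ultimately show "openin (quot_top S) {x \<in> topspace (quot_top S). quot_map S \<int> \<kappa> x \<in> U}"
      by (auto simp: openin_quot_top topspace_quot_top quot_carrier)
  qed (auto simp: topspace_quot_top coset)
  then show ?thesis
    using quot_map_Hom [OF S add_subgroup_Ints add \<kappa>(2)]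
    by (simp add: characters_def ell_def RZ_def)
qed

text \<open>The real linear lift agrees near \<open>0\<close> with a holomorphic function up to a constant, so it is its own
  derivative at \<open>0\<close> and that derivative is complex linear.\<close>

lemma holomorphic_hom_is_multiplication:
  assumes L: "add_subgroup L" and L': "add_subgroup L'"
    and discrete: "e > 0" "\<And>d. d \<in> L' \<Longrightarrow> norm d < e \<Longrightarrow> d = 0"
    and f: "f \<in> Hom (ell L) (ell L')" "holomorphic_ell L L' f"
  obtains l where "\<And>z. f (coset L z) = coset L' (l * z)"
proof -
  have hom: "f \<in> hom (add_grp UNIV Mod L) (add_grp UNIV Mod L')"
    using f by (auto simp: Hom_def ell_def)
  have UNIV: "add_subgroup (UNIV :: complex set)" by (rule add_subgroupI) auto
  obtain F where F: "F 0 = 0" "\<And>z. f (coset L z) = coset L' (F z)"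
    "\<And>z w. F (z + w) - F z - F w \<in> L'"
    using quot_hom_lift [OF hom L L' UNIV] by auto
  obtain U g where U: "open U" "0 \<in> U" "g holomorphic_on U"
    and Ug: "\<forall>z\<in>U. f (coset L z) = coset L' (g z)"
    using f(2) [unfolded holomorphic_ell_def, rule_format, of 0] by (elim exE conjE)
  have g: "F z - g z \<in> L'" if "z \<in> U" for z
    using bspec [OF Ug that] F(2) [of z] coset_eq_iff [OF L', of "F z" "g z"] by simp
  have g0: "g 0 \<in> L'"
    using g [OF U(2)] F(1) add_subgroup_mem(3) [OF L'] by fastforce
  obtain l where l: "(g has_field_derivative l) (at 0)"
    using holomorphic_on_imp_differentiable_at [OF U(3,1,2)]
    unfolding field_differentiable_def by blast
  then have "isCont g 0" by (rule DERIV_isCont)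
  then have "\<exists>r1>0. \<forall>z. dist z 0 < r1 \<longrightarrow> dist (g z) (g 0) < e / 3"
    unfolding continuous_at_eps_delta by (rule allE [of _ "e / 3"]) (simp add: discrete(1))
  then obtain r1 where r1: "r1 > 0" "\<And>z. norm z < r1 \<Longrightarrow> norm (g z - g 0) < e / 3"
    by (auto simp: dist_norm)
  obtain r2 where r2: "r2 > 0" "ball 0 r2 \<subseteq> U"
    using U(1,2) open_contains_ball by blast
  define r where "r = min r1 r2"
  have r: "r > 0" "\<And>z. norm z < r \<Longrightarrow> F z - (g z - g 0) \<in> L'"
    "\<And>z. norm z < r \<Longrightarrow> norm (g z - g 0) < e / 3"
  proof -
    fix z :: complex assume z: "norm z < r"
    then have "z \<in> U" using r2 by (auto simp: r_def)
    then have "F z - g z + g 0 \<in> L'" by (intro add_subgroup_mem(2) [OF L' g g0])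
    then show "F z - (g z - g 0) \<in> L'" by (simp add: algebra_simps)
  qed (use r1 r2 in \<open>auto simp: r_def\<close>)
  obtain \<kappa> where \<kappa>: "linear \<kappa>" "\<And>z. F z - \<kappa> z \<in> L'" "\<And>z. norm z < r \<Longrightarrow> \<kappa> z = g z - g 0"
    by (rule local_lift_extends_linear
          [where D = L' and F = F and g = "\<lambda>z. g z - g 0" and e = e and r = r])
       (use L' discrete(2) F(3) r in blast)+
  have "((\<lambda>z. g z - g 0) has_derivative (*) l) (at 0)"
    using l by (auto simp: has_field_derivative_def intro!: derivative_eq_intros)
  then have "(\<kappa> has_derivative (*) l) (at 0)"
    by (rule has_derivative_transform_within_open [of _ _ _ _ "ball 0 r"]) (use \<kappa> r in auto)
  moreover have "(\<kappa> has_derivative \<kappa>) (at 0)"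
    using \<kappa>(1) unfolding linear_conv_bounded_linear by (rule bounded_linear_imp_has_derivative)
  ultimately have "(*) l = \<kappa>" by (rule has_derivative_unique)
  with \<kappa>(2) have "F z - l * z \<in> L'" for z by metis
  then show thesis
    by (intro that [of l]) (simp add: F(2) coset_eq_iff L')
qed

section \<open>Lattices in the complex plane\<close>

text \<open>\<open>Im (cnj w1 * w2)\<close> is the determinant of \<open>w1\<close> and \<open>w2\<close> with respect to the basis \<open>1, \<i>\<close>. Pairing with
  a generator in this way extracts the other coefficient of a lattice vector, which is how
  discreteness is shown below.\<close>

lemma independent_complex_iff:
  "w1 \<noteq> w2 \<and> independent {w1, w2} \<longleftrightarrow> Im (cnj w1 * w2) \<noteq> 0"
proof
  assume indep: "w1 \<noteq> w2 \<and> independent {w1, w2}"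
  then have w1: "w1 \<noteq> 0" using dependent_zero [of "{w1, w2}"] by auto
  show "Im (cnj w1 * w2) \<noteq> 0"
  proof
    assume "Im (cnj w1 * w2) = 0"
    then have "cnj w1 * w2 = of_real (Re (cnj w1 * w2))"
      by (simp add: complex_eq_iff)
    then have "w1 * cnj w1 * w2 = w1 * of_real (Re (cnj w1 * w2))"
      by (simp only: mult.assoc)
    then have "of_real ((norm w1)\<^sup>2) * w2 = of_real (Re (cnj w1 * w2)) * w1"
      by (simp only: complex_norm_square mult.commute)
    then have "w2 = (Re (cnj w1 * w2) / (norm w1)\<^sup>2) *\<^sub>R w1"
      using w1 by (simp add: scaleR_conv_of_real divide_simps mult.commute del: of_real_mult)
    then have "w2 \<in> span {w1}"
      by (metis span_base span_scale singletonI)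
    with indep show False
      using independent_insert [of w2 "{w1}"] by (auto simp: insert_commute)
  qed
next
  assume *: "Im (cnj w1 * w2) \<noteq> 0"
  then have "w1 \<noteq> 0" by auto
  moreover have "w2 \<notin> span {w1}"
  proof
    assume "w2 \<in> span {w1}"
    then obtain t where "w2 = t *\<^sub>R w1" by (auto simp: span_singleton)
    with * show False by simp
  qed
  moreover have "w1 \<noteq> w2" using * by auto
  ultimately show "w1 \<noteq> w2 \<and> independent {w1, w2}"
    using independent_insert [of w2 "{w1}"] by (auto simp: insert_commute dependent_single)
qed

lemma lattice_add_subgroup:
  assumes "lattice_in_complex L"
  shows "add_subgroup L"
proof -
  obtain w1 w2 where L: "L = {of_int m * w1 + of_int n * w2 | m n. True}"
    using assms by (auto simp: lattice_in_complex_def)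
  show ?thesis
  proof (rule add_subgroupI)
    have "0 = of_int 0 * w1 + of_int 0 * w2" by simp
    then show "0 \<in> L" unfolding L by blast
    fix x y assume "x \<in> L" "y \<in> L"
    then obtain m n m' n' where "x = of_int m * w1 + of_int n * w2" "y = of_int m' * w1 + of_int n' * w2"
      unfolding L by blast
    then have "x - y = of_int (m - m') * w1 + of_int (n - n') * w2" by (simp add: algebra_simps)
    then show "x - y \<in> L" unfolding L by blast
  qed
qed

lemma lattice_discrete:
  assumes "lattice_in_complex L"
  obtains e where "e > 0" "\<And>d. d \<in> L \<Longrightarrow> norm d < e \<Longrightarrow> d = 0"
proof -
  obtain w1 w2 where D: "Im (cnj w1 * w2) \<noteq> 0" (is "?D \<noteq> 0")
    and L: "L = {of_int m * w1 + of_int n * w2 | m n. True}"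
    using assms unfolding lattice_in_complex_def conj_assoc [symmetric] independent_complex_iff by blast
  define e where "e = \<bar>?D\<bar> / (norm w1 + norm w2)"
  have w: "norm w1 > 0" "norm w2 > 0" using D by auto
  show thesis
  proof (rule that)
    show "e > 0" using D w by (simp add: e_def add_pos_pos)
    fix d assume "d \<in> L" and d: "norm d < e"
    then obtain m n where mn: "d = of_int m * w1 + of_int n * w2" unfolding L by blast
    have small: "norm d * norm w1 < \<bar>?D\<bar>" "norm d * norm w2 < \<bar>?D\<bar>"
    proof -
      have "norm d * (norm w1 + norm w2) < \<bar>?D\<bar>"
        using d w by (simp add: e_def field_simps add_pos_pos)
      moreover have "0 \<le> norm d * norm w1" "0 \<le> norm d * norm w2" by simp_all
      ultimately show "norm d * norm w1 < \<bar>?D\<bar>" "norm d * norm w2 < \<bar>?D\<bar>"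
        unfolding distrib_left by linarith+
    qed
    have "Im (cnj w1 * d) = of_int n * ?D" "Im (cnj w2 * d) = - of_int m * ?D"
      by (simp_all add: mn algebra_simps)
    moreover have "\<bar>Im (cnj w1 * d)\<bar> \<le> norm d * norm w1" "\<bar>Im (cnj w2 * d)\<bar> \<le> norm d * norm w2"
      using abs_Im_le_cmod [of "cnj w1 * d"] abs_Im_le_cmod [of "cnj w2 * d"]
      by (simp_all add: norm_mult mult.commute)
    ultimately have "\<bar>of_int n\<bar> * \<bar>?D\<bar> < 1 * \<bar>?D\<bar>" "\<bar>of_int m\<bar> * \<bar>?D\<bar> < 1 * \<bar>?D\<bar>"
      using small by (auto simp: abs_mult)
    then have "m = 0" "n = 0" using D by (auto simp: mult_less_cancel_right)
    then show "d = 0" by (simp add: mn)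
  qed
qed

lemma lattice_uniform_multiple:
  assumes L: "lattice_in_complex L" and M: "add_subgroup M"
    and multiple: "\<And>w. w \<in> L \<Longrightarrow> \<exists>n>0. of_nat n * w \<in> M"
  obtains N :: nat where "N > 0" "\<And>w. w \<in> L \<Longrightarrow> of_nat N * w \<in> M"
proof -
  obtain w1 w2 where L_eq: "L = {of_int m * w1 + of_int n * w2 | m n. True}"
    using L by (auto simp: lattice_in_complex_def)
  have "w1 = of_int 1 * w1 + of_int 0 * w2" "w2 = of_int 0 * w1 + of_int 1 * w2" by simp_all
  then have "w1 \<in> L" "w2 \<in> L" unfolding L_eq by blast+
  then obtain n1 n2 where n: "n1 > 0" "of_nat n1 * w1 \<in> M" "n2 > 0" "of_nat n2 * w2 \<in> M"
    using multiple by metis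
  show thesis
  proof (rule that)
    show "n1 * n2 > 0" using n by simp
    fix w assume "w \<in> L"
    then obtain i j where w: "w = of_int i * w1 + of_int j * w2" unfolding L_eq by blast
    have "of_int (i * int n2) * (of_nat n1 * w1) + of_int (j * int n1) * (of_nat n2 * w2) \<in> M"
      by (intro add_subgroup_mem(2) [OF M] add_subgroup_of_int_mult [OF M] n)
    then show "of_nat (n1 * n2) * w \<in> M" by (simp add: w algebra_simps)
  qed
qed

lemma rat_mult_multiple:
  assumes L: "add_subgroup L" and "w \<in> rat_mult L"
  shows "\<exists>n>0. of_nat n * w \<in> L"
proof -
  obtain q z where w: "w = q *\<^sub>R z" "q \<in> \<rat>" "z \<in> L"
    using assms(2) by (auto simp: rat_mult_def)
  obtain i j where q: "q = of_int i / of_int j" "j > 0"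
    using Rats_cases' [OF w(2)] by metis
  have "of_nat (nat j) * w = of_int i * z"
    using q by (simp add: w(1) scaleR_conv_of_real)
  then show ?thesis
    using add_subgroup_of_int_mult [OF L w(3)] q(2) by (intro exI [of _ "nat j"]) simp
qed

lemma rat_mult_subset:
  assumes "N > 0" and "\<And>z. z \<in> L \<Longrightarrow> of_nat N * z \<in> L'"
  shows "rat_mult L \<subseteq> rat_mult L'"
proof
  fix x assume "x \<in> rat_mult L"
  then obtain q z where x: "x = q *\<^sub>R z" "q \<in> \<rat>" "z \<in> L" by (auto simp: rat_mult_def)
  have "x = (q / of_nat N) *\<^sub>R (of_nat N * z)"
    using assms(1) by (simp add: x(1) scaleR_conv_of_real)
  moreover have "q / of_nat N \<in> \<rat>" using x(2) by simp
  ultimately show "x \<in> rat_mult L'" using assms(2) [OF x(3)] unfolding rat_mult_def by blast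
qed

lemma subset_rat_mult: "L \<subseteq> rat_mult L"
  unfolding rat_mult_def using scaleR_one [symmetric] Rats_1 by fast

lemma add_subgroup_sum:
  fixes H K :: "'a::ab_group_add set"
  assumes "add_subgroup H" "add_subgroup K"
  shows "add_subgroup {x + y | x y. x \<in> H \<and> y \<in> K}"
proof (rule add_subgroupI)
  have "0 = 0 + (0 :: 'a)" by simp
  then show "0 \<in> {x + y | x y. x \<in> H \<and> y \<in> K}"
    using add_subgroup_mem(1) assms by blast
  fix p q assume "p \<in> {x + y | x y. x \<in> H \<and> y \<in> K}" "q \<in> {x + y | x y. x \<in> H \<and> y \<in> K}"
  then obtain x y x' y' where *: "p = x + y" "x \<in> H" "y \<in> K" "q = x' + y'" "x' \<in> H" "y' \<in> K"
    by blast
  have "p - q = (x - x') + (y - y')" by (simp add: *)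
  then show "p - q \<in> {x + y | x y. x \<in> H \<and> y \<in> K}"
    using add_subgroup_mem(4) [OF assms(1) *(2,5)] add_subgroup_mem(4) [OF assms(2) *(3,6)] by blast
qed

section \<open>Multiplication maps and isogenies\<close>

lemma mult_additive: "Modules.additive ((*) (c :: 'a::ring))"
  by unfold_locales (simp add: distrib_left)

text \<open>The kernel is finite because \<open>N\<close> kills it: its elements are combinations of two classes with
  coefficients that matter only modulo \<open>N\<close>.\<close>

lemma quot_map_mult_isogeny:
  assumes L: "lattice_in_complex L" and L': "lattice_in_complex L'"
    and c: "c \<noteq> 0" "(*) c ` L \<subseteq> L'"
    and N: "N > 0" "\<And>z. z \<in> L' \<Longrightarrow> of_nat N * z \<in> (*) c ` L"
  shows "isogeny L L' (quot_map L L' ((*) c))"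
proof -
  note H = lattice_add_subgroup [OF L] and H' = lattice_add_subgroup [OF L']
  note coset = quot_map_coset [OF H H' mult_additive c(2)]
  let ?f = "quot_map L L' ((*) c)"
  obtain w1 w2 where L'_eq: "L' = {of_int m * w1 + of_int n * w2 | m n. True}"
    using L' by (auto simp: lattice_in_complex_def)
  have "w1 = of_int 1 * w1 + of_int 0 * w2" "w2 = of_int 0 * w1 + of_int 1 * w2" by simp_all
  then have w: "w1 \<in> L'" "w2 \<in> L'" unfolding L'_eq by blast+
  have N_div: "of_nat N * (z / c) \<in> L" if "z \<in> L'" for z
    using N(2) [OF that] c(1) by (auto simp: field_simps)
  have kernel: "kernel (ell L) (ell L') ?f
      \<subseteq> (\<lambda>(i, j). coset L (of_int i * (w1 / c) + of_int j * (w2 / c))) ` ({0..<int N} \<times> {0..<int N})"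
  proof
    fix X assume "X \<in> kernel (ell L) (ell L') ?f"
    then obtain z where z: "X = coset L z" "c * z \<in> L'"
      by (auto simp: kernel_def ell_def quot_carrier coset coset_eq_subgroup_iff H')
    then obtain i j where ij: "c * z = of_int i * w1 + of_int j * w2" unfolding L'_eq by blast
    let ?i = "i mod int N" and ?j = "j mod int N"
    have "z - (of_int ?i * (w1 / c) + of_int ?j * (w2 / c))
        = of_int (i div int N) * (of_nat N * (w1 / c)) + of_int (j div int N) * (of_nat N * (w2 / c))"
    proof -
      have "z = (of_int i * w1 + of_int j * w2) / c"
        using ij c(1) by (simp add: field_simps)
      also have "\<dots> = of_int i * (w1 / c) + of_int j * (w2 / c)"
        by (simp add: add_divide_distrib)
      finally have z_eq: "z = of_int i * (w1 / c) + of_int j * (w2 / c)" .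
      have diff: "of_int k - of_int (k mod int N) = of_int (k div int N) * (of_nat N :: complex)" for k
      proof -
        have "k - k mod int N = k div int N * int N" by (simp add: minus_mod_eq_div_mult)
        then show ?thesis by (metis of_int_diff of_int_mult of_int_of_nat_eq)
      qed
      have "p * u + q * v - (p' * u + q' * v) = (p - p') * u + (q - q') * v" for p q p' q' u v :: complex
        by (simp add: algebra_simps)
      then show ?thesis
        unfolding z_eq by (simp only: diff mult.assoc)
    qed
    also have "\<dots> \<in> L"
      by (intro add_subgroup_mem(2) [OF H] add_subgroup_of_int_mult [OF H] N_div w)
    finally have "X = coset L (of_int ?i * (w1 / c) + of_int ?j * (w2 / c))"
      using z(1) by (simp add: coset_eq_iff H)
    moreover have "(?i, ?j) \<in> {0..<int N} \<times> {0..<int N}" using N(1) by simp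
    ultimately show "X \<in> (\<lambda>(i, j). coset L (of_int i * (w1 / c) + of_int j * (w2 / c)))
        ` ({0..<int N} \<times> {0..<int N})"
      by (intro image_eqI [of _ _ "(?i, ?j)"]) auto
  qed
  have "?f \<in> Hom (ell L) (ell L')"
    using quot_map_Hom [OF H H' mult_additive c(2)] by (simp add: ell_def)
  moreover have "holomorphic_ell L L' ?f"
    unfolding holomorphic_ell_def
    by (intro allI exI [of _ UNIV] exI [of _ "(*) c"] conjI ballI coset holomorphic_intros) simp_all
  moreover have "?f ` carrier (ell L) = carrier (ell L')"
  proof -
    have "coset L' z = ?f (coset L (z / c))" for z
      using c(1) by (simp add: coset)
    then have "range (coset L') \<subseteq> ?f ` range (coset L)" by blast
    moreover have "?f ` range (coset L) \<subseteq> range (coset L')" by (auto simp: coset)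
    ultimately show ?thesis by (simp add: ell_def quot_carrier)
  qed
  moreover have "finite (kernel (ell L) (ell L') ?f)"
    by (rule finite_subset [OF kernel]) simp
  ultimately show ?thesis by (simp add: isogeny_def)
qed

text \<open>Conversely, for \<open>w \<in> L'\<close> the multiples of \<open>w / l\<close> represent elements of the finite kernel, so two of
  them agree modulo \<open>L\<close> and some positive multiple of \<open>w / l\<close> lies in \<open>L\<close>; treating two generators
  of \<open>L'\<close> gives a common multiple \<open>N\<close>.\<close>

lemma isogenyE:
  assumes L: "lattice_in_complex L" and L': "lattice_in_complex L'" and f: "isogeny L L' f"
  obtains l N where "\<And>z. f (coset L z) = coset L' (l * z)" "l \<noteq> 0"
    "N > 0" "\<And>z. z \<in> L' \<Longrightarrow> of_nat N * z \<in> (*) l ` L"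
proof -
  note H = lattice_add_subgroup [OF L] and H' = lattice_add_subgroup [OF L']
  obtain e where e: "e > 0" "\<And>d. d \<in> L' \<Longrightarrow> norm d < e \<Longrightarrow> d = 0"
    using lattice_discrete [OF L'] by metis
  have fin: "finite (kernel (ell L) (ell L') f)" and surj: "f ` carrier (ell L) = carrier (ell L')"
    using f by (auto simp: isogeny_def)
  obtain l where l: "\<And>z. f (coset L z) = coset L' (l * z)"
    by (rule holomorphic_hom_is_multiplication [OF H H' e, of f])
       (use f in \<open>auto simp: isogeny_def\<close>)
  have "l \<noteq> 0"
  proof
    assume "l = 0"
    then have "f ` carrier (ell L) \<subseteq> {L'}" by (auto simp: ell_def quot_carrier l)
    then have "coset L' (of_real (e / 2)) = L'"
      using surj by (auto simp: ell_def quot_carrier)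
    then have "of_real (e / 2) \<in> L'" by (simp add: coset_eq_subgroup_iff H')
    with e(2) [of "of_real (e / 2)"] e(1) show False by simp
  qed
  have "\<exists>n>0. of_nat n * w \<in> (*) l ` L" if w: "w \<in> L'" for w
  proof -
    define h where "h n = coset L (of_nat n * (w / l))" for n :: nat
    have "h n \<in> kernel (ell L) (ell L') f" for n
      using add_subgroup_of_int_mult [OF H' w, of "int n"] \<open>l \<noteq> 0\<close>
      by (simp add: h_def kernel_def ell_def quot_carrier l coset_eq_subgroup_iff H')
    then have "\<not> inj h"
      using fin finite_subset [of "range h"] finite_imageD [of h UNIV] by blast
    then obtain m n where mn: "m < n" "h m = h n"
      unfolding inj_def by (metis nat_neq_iff)
    then have "of_nat n * (w / l) - of_nat m * (w / l) \<in> L"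
      using coset_eq_iff [OF H, of "of_nat n * (w / l)" "of_nat m * (w / l)"] by (simp add: h_def)
    then have "of_nat (n - m) * (w / l) \<in> L"
      using mn(1) by (simp add: of_nat_diff left_diff_distrib diff_divide_distrib)
    moreover have "of_nat (n - m) * w = l * (of_nat (n - m) * (w / l))"
      using \<open>l \<noteq> 0\<close> by simp
    ultimately show ?thesis
      using mn(1) by (intro exI [of _ "n - m"]) (metis imageI zero_less_diff)
  qed
  then obtain N where "N > 0" "\<And>w. w \<in> L' \<Longrightarrow> of_nat N * w \<in> (*) l ` L"
    using lattice_uniform_multiple [OF L' add_subgroup_mult_image [OF H, of l]] by metis
  with l \<open>l \<noteq> 0\<close> show thesis by (rule that)
qed

lemma isogeny_mult_subset:
  fixes l :: "'a::ring"
  assumes "add_subgroup L" "add_subgroup L'" and "\<And>z. f (coset L z) = coset L' (l * z)"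
  shows "(*) l ` L \<subseteq> L'"
proof
  fix x assume "x \<in> (*) l ` L"
  then obtain z where z: "z \<in> L" "x = l * z" by blast
  have "coset L' (l * z) = coset L' (l * 0)"
    using assms(3) [of z] assms(3) [of 0] coset_eq_subgroup_iff [OF assms(1), of z] z(1) by simp
  then show "x \<in> L'" using z(2) coset_eq_iff [OF assms(2), of "l * z" "l * 0"] by simp
qed

lemma T_map_coset:
  assumes "r \<in> \<rat>"
  shows "T_map h \<xi> (coset \<int> r) = h (\<xi> (coset \<int> r))"
  using assms by (simp add: T_map_def compose_def QZ_carrier)

lemma T_map_mult_TE:
  assumes L: "lattice_in_complex L" and L': "lattice_in_complex L'"
    and c: "(*) c ` L \<subseteq> L'" and \<xi>: "\<xi> \<in> TE L"
  shows "T_map (quot_map L L' ((*) c)) \<xi> \<in> TE L'"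
proof -
  note H = lattice_add_subgroup [OF L] and H' = lattice_add_subgroup [OF L']
  note coset = quot_map_coset [OF H H' mult_additive c]
  have hom: "\<xi> \<in> hom (add_grp \<rat> Mod \<int>) (add_grp (rat_mult L) Mod L)"
    using \<xi> by (auto simp: TE_def Hom_def QZ_def ell_tor_def)
  have "0 \<in> rat_mult L" using subset_rat_mult add_subgroup_mem(1) [OF H] by blast
  then obtain X where X: "\<And>r. r \<in> \<rat> \<Longrightarrow> X r \<in> rat_mult L \<and> \<xi> (coset \<int> r) = coset L (X r)"
    "\<And>r s. r \<in> \<rat> \<Longrightarrow> s \<in> \<rat> \<Longrightarrow> X (r + s) - X r - X s \<in> L"
    using quot_hom_lift [OF hom add_subgroup_Ints H add_subgroup_Rats] by metis
  have mem: "c * X r \<in> rat_mult L'" if r: "r \<in> \<rat>" for r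
  proof -
    obtain q z where "X r = q *\<^sub>R z" "q \<in> \<rat>" "z \<in> L"
      using X(1) [OF r] by (auto simp: rat_mult_def)
    then have "c * X r = q *\<^sub>R (c * z)" "q \<in> \<rat>" "c * z \<in> L'" using c by auto
    then show ?thesis unfolding rat_mult_def by blast
  qed
  have add: "coset L' (c * X (r + s)) = coset L' (c * X r + c * X s)" if "r \<in> \<rat>" "s \<in> \<rat>" for r s
  proof -
    have "c * (X (r + s) - X r - X s) \<in> L'" using X(2) [OF that] c by auto
    then show ?thesis by (simp add: coset_eq_iff H' algebra_simps)
  qed
  have val: "T_map (quot_map L L' ((*) c)) \<xi> (coset \<int> r) = coset L' (c * X r)" if "r \<in> \<rat>" for r
    using that X(1) by (simp add: T_map_coset coset)
  show ?thesis
    unfolding TE_def Hom_def hom_def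
    using val mem add
    by (auto simp: QZ_carrier QZ_mult ell_tor_def quot_carrier quot_mult H')
       (auto simp: T_map_def compose_def extensional_def QZ_carrier)
qed

section \<open>Coordinates of a parabolic \<open>\<rat>\<close>-lattice\<close>

text \<open>\<open>par_pt a b\<close> is \<open>\<alpha>\<inverse>\<close>: the point with coordinates \<open>\<alpha>\<inverse>(x, y)\<close> in the basis \<open>(e\<^sub>1, e\<^sub>2)\<close>. It leaves the
  second coordinate, minus the imaginary part, unchanged.\<close>

definition par_pt :: "real \<Rightarrow> real \<Rightarrow> real \<Rightarrow> real \<Rightarrow> complex" where
  "par_pt a b x y = Complex ((x - b * y) / a) (- y)"

lemma par_pt_simps [simp]:
  "Re (par_pt a b x y) = (x - b * y) / a" "Im (par_pt a b x y) = - y"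
  by (simp_all add: par_pt_def)

lemma par_pt_add: "par_pt a b x y + par_pt a b x' y' = par_pt a b (x + x') (y + y')"
  and par_pt_diff: "par_pt a b x y - par_pt a b x' y' = par_pt a b (x - x') (y - y')"
  and par_pt_mult: "of_real k * par_pt a b x y = par_pt a b (k * x) (k * y)"
  by (simp_all add: complex_eq_iff algebra_simps add_divide_distrib diff_divide_distrib)

lemma inv_alpha: "a \<noteq> 0 \<Longrightarrow> inv_into UNIV (alpha a b) z = par_pt a b (Re z) (- Im z)"
  by (rule inv_f_eq) (auto simp: inj_def alpha_def e1_def e2_def complex_eq_iff)

lemma image_Collect2: "f ` {g x y | x y. P x y} = {f (g x y) | x y. P x y}"
  by blast

lemma parabolic_lattice_eq:
  assumes "a \<noteq> 0"
  shows "inv_into UNIV (alpha a b) ` Lambda0 = {par_pt a b (of_int m) (of_int n) | m n. True}"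
proof -
  have "inv_into UNIV (alpha a b) (of_int m * e1 + of_int n * e2) = par_pt a b (of_int m) (of_int n)"
    for m n
    using assms by (simp add: inv_alpha e1_def e2_def)
  then show ?thesis unfolding Lambda0_def image_Collect2 by simp
qed

text \<open>The coordinates \<open>(a, b, u, v)\<close> of a parabolic \<open>\<rat>\<close>-lattice, with \<open>u\<close> and \<open>v\<close> replaced by
  functions \<open>U\<close> and \<open>V\<close> on \<open>\<rat>\<close> lifting them; the last condition says \<open>u \<noteq> 0\<close>.\<close>

locale parabolic_coordinates =
  fixes \<Lambda> :: "complex set" and a b :: real and U V :: "real \<Rightarrow> real"
  assumes a_pos: "a > 0"
    and \<Lambda>_eq: "\<Lambda> = {par_pt a b (of_int m) (of_int n) | m n. True}"
    and U_0: "U 0 = 0" and V_0: "V 0 = 0"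
    and U_add: "\<And>r s. r \<in> \<rat> \<Longrightarrow> s \<in> \<rat> \<Longrightarrow> U (r + s) - U r - U s \<in> \<int>"
    and V_add: "\<And>r s. r \<in> \<rat> \<Longrightarrow> s \<in> \<rat> \<Longrightarrow> V (r + s) - V r - V s \<in> \<int>"
    and U_nonzero: "\<exists>r\<in>\<rat>. U r \<notin> \<int>"
begin

abbreviation "pt \<equiv> par_pt a b"

lemma pt_mem: "x \<in> \<int> \<Longrightarrow> y \<in> \<int> \<Longrightarrow> pt x y \<in> \<Lambda>"
  by (auto simp: \<Lambda>_eq elim!: Ints_cases)

lemma mem_Im: "z \<in> \<Lambda> \<Longrightarrow> Im z \<in> \<int>"
  by (auto simp: \<Lambda>_eq)

lemma mem_real:
  assumes "z \<in> \<Lambda>" "Im z = 0"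
  obtains m :: int where "z = of_real (of_int m / a)"
  using assms by (auto simp: \<Lambda>_eq complex_eq_iff)

lemma lattice: "lattice_in_complex \<Lambda>"
proof -
  have "Im (cnj (pt 1 0) * pt 0 1) \<noteq> 0" using a_pos by simp
  moreover have "\<Lambda> = {of_int m * pt 1 0 + of_int n * pt 0 1 | m n. True}"
  proof -
    have "of_int m * pt 1 0 + of_int n * pt 0 1 = pt (of_int m) (of_int n)" for m n
      using par_pt_mult [of "of_int m" a b 1 0] par_pt_mult [of "of_int n" a b 0 1]
      by (simp add: par_pt_add)
    then show ?thesis by (simp add: \<Lambda>_eq)
  qed
  ultimately show ?thesis
    unfolding lattice_in_complex_def conj_assoc [symmetric] independent_complex_iff by blast
qed

lemma subgroup: "add_subgroup \<Lambda>"
  using lattice by (rule lattice_add_subgroup)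

lemma nat_mult:
  fixes F :: "real \<Rightarrow> real"
  assumes "F 0 = 0" "\<And>r s. r \<in> \<rat> \<Longrightarrow> s \<in> \<rat> \<Longrightarrow> F (r + s) - F r - F s \<in> \<int>" "r \<in> \<rat>"
  shows "F (of_nat k * r) - of_nat k * F r \<in> \<int>"
proof (induction k)
  case (Suc k)
  have "(F (of_nat k * r) - of_nat k * F r) + (F (of_nat k * r + r) - F (of_nat k * r) - F r) \<in> \<int>"
    by (intro Ints_add Suc.IH assms) (use assms(3) in auto)
  then show ?case by (simp add: algebra_simps)
qed (simp add: assms(1))

text \<open>\<open>Hom(\<rat>/\<int>, \<rat>/\<int>)\<close> is torsion free because \<open>\<rat>/\<int>\<close> is divisible.\<close>

lemma U_torsion_free:
  assumes "\<And>r. r \<in> \<rat> \<Longrightarrow> of_int k * U r \<in> \<int>"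
  shows "k = 0"
proof (rule ccontr)
  assume "k \<noteq> 0"
  define n where "n = nat \<bar>k\<bar>"
  have n: "n > 0" "of_nat n = \<bar>real_of_int k\<bar>" using \<open>k \<noteq> 0\<close> by (auto simp: n_def)
  have "U r \<in> \<int>" if r: "r \<in> \<rat>" for r
  proof -
    have "r / of_nat n \<in> \<rat>" using r by simp
    then have "U (of_nat n * (r / of_nat n)) - of_nat n * U (r / of_nat n) \<in> \<int>"
      by (intro nat_mult U_0 U_add)
    moreover have "of_nat n * U (r / of_nat n) \<in> \<int>"
      using assms [OF \<open>r / of_nat n \<in> \<rat>\<close>] Ints_minus [of "of_int k * U (r / of_nat n)"]
      by (auto simp: n(2) abs_if)
    ultimately have "U (of_nat n * (r / of_nat n)) \<in> \<int>"
      using Ints_add by fastforce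
    then show ?thesis using n(1) by simp
  qed
  with U_nonzero show False by blast
qed

lemma pt_nat_mult:
  assumes "r \<in> \<rat>" "t \<in> \<rat>"
  shows "pt (U (of_nat k * r) + V (of_nat k * t)) (of_nat k * t) - of_nat k * pt (U r + V t) t \<in> \<Lambda>"
proof -
  have "(U (of_nat k * r) - of_nat k * U r) + (V (of_nat k * t) - of_nat k * V t) \<in> \<int>"
    by (intro Ints_add nat_mult U_0 U_add V_0 V_add assms)
  then have "pt ((U (of_nat k * r) - of_nat k * U r) + (V (of_nat k * t) - of_nat k * V t)) 0 \<in> \<Lambda>"
    by (intro pt_mem) auto
  then show ?thesis
    using par_pt_mult [of "of_nat k" a b "U r + V t" t] by (simp add: par_pt_diff algebra_simps)
qed

end

text \<open>Multiplication by \<open>\<nu>\<close> sends the real generator of \<open>\<Lambda>'\<close> to a lattice vector with second coordinate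
  \<open>n\<close>, say. As \<open>\<phi>(x, 0)\<close> and \<open>\<phi>'(x, 0)\<close> have second coordinate \<open>0\<close>, the integer \<open>n\<close> kills \<open>u'\<close>, so it
  vanishes and \<open>\<nu>\<close> is real. As \<open>\<phi>(0, y)\<close> and \<open>\<phi>'(0, y)\<close> have second coordinate \<open>y\<close>, it follows that
  \<open>\<nu> t = N t\<close> modulo \<open>\<int>\<close> for all rational \<open>t\<close>.

  The factor \<open>N\<close> serves \<open>\<rat>\<close>-lattices that agree only modulo a larger lattice \<open>M\<close>: multiplying by \<open>N\<close>
  with \<open>N M \<subseteq> \<Lambda>\<close> yields a relation modulo \<open>\<Lambda>\<close>.\<close>

lemma parabolic_rigidity:
  assumes "parabolic_coordinates \<Lambda> a b U V" and "parabolic_coordinates \<Lambda>' a' b' U' V'"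
    and sub: "\<And>z. z \<in> \<Lambda>' \<Longrightarrow> \<nu> * z \<in> \<Lambda>"
    and \<xi>: "\<And>r. r \<in> \<rat> \<Longrightarrow> of_nat N * par_pt a b (U r) 0 - \<nu> * par_pt a' b' (U' r) 0 \<in> \<Lambda>"
    and \<eta>: "\<And>t. t \<in> \<rat> \<Longrightarrow> of_nat N * par_pt a b (V t) t - \<nu> * par_pt a' b' (V' t) t \<in> \<Lambda>"
  shows "\<nu> = of_nat N"
proof -
  interpret P: parabolic_coordinates \<Lambda> a b U V by fact
  interpret P': parabolic_coordinates \<Lambda>' a' b' U' V' by fact
  have "P'.pt 1 0 \<in> \<Lambda>'" "P'.pt 0 1 \<in> \<Lambda>'" by (auto intro: P'.pt_mem)
  note gens = P.mem_Im [OF sub, OF this(1)] P.mem_Im [OF sub, OF this(2)]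
  from gens(1) have "Im \<nu> / a' \<in> \<int>" by simp
  then obtain n where n: "Im \<nu> / a' = of_int n" by (auto elim: Ints_cases)
  have "of_int n * U' r \<in> \<int>" if "r \<in> \<rat>" for r
    using Ints_minus [OF P.mem_Im [OF \<xi> [OF that]]] by (simp add: n [symmetric])
  then have "n = 0" by (rule P'.U_torsion_free)
  then have Im: "Im \<nu> = 0" using n P'.a_pos by simp
  define \<delta> where "\<delta> = Re \<nu> - of_nat N"
  have \<delta>_mult: "\<delta> * t \<in> \<int>" if "t \<in> \<rat>" for t
    using P.mem_Im [OF \<eta> [OF that]] Im by (simp add: \<delta>_def algebra_simps)
  have "\<delta> \<in> \<int>" using \<delta>_mult [of 1] by simp
  have "\<delta> = 0"
  proof (rule ccontr)
    assume "\<delta> \<noteq> 0"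
    \<comment> \<open>evaluate at a rational number that \<open>\<delta>\<close> does not multiply into \<open>\<int>\<close>\<close>
    have "1 / (2 * \<delta>) \<in> \<rat>" using \<open>\<delta> \<in> \<int>\<close> by (auto elim: Ints_cases)
    then have "\<delta> * (1 / (2 * \<delta>)) \<in> \<int>" by (rule \<delta>_mult)
    then have "1 / 2 \<in> (\<int> :: real set)" using \<open>\<delta> \<noteq> 0\<close> by simp
    then obtain k where "1 / 2 = real_of_int k" by (auto elim: Ints_cases)
    then have "1 = 2 * k" by linarith
    then show False by presburger
  qed
  with Im show ?thesis by (simp add: complex_eq_iff \<delta>_def)
qed

text \<open>The real elements of the sum are generated by \<open>1/a\<close>, \<open>1/a'\<close> and the difference of the two
  generators with second coordinate \<open>1\<close>. All three are integral multiples of \<open>1/(N a)\<close>, so the group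
  is cyclic, generated by a greatest common divisor.\<close>

lemma parabolic_sum_lattice:
  assumes "parabolic_coordinates \<Lambda> a b U V" and "parabolic_coordinates \<Lambda>' a' b' U' V'"
    and N: "N > 0" "\<And>z. z \<in> \<Lambda>' \<Longrightarrow> of_nat N * z \<in> \<Lambda>"
  obtains d where "d > 0" "{x + y | x y. x \<in> \<Lambda> \<and> y \<in> \<Lambda>'}
    = {of_int m * of_real d + of_int n * par_pt a b 0 1 | m n. True}"
proof -
  interpret P: parabolic_coordinates \<Lambda> a b U V by fact
  interpret P': parabolic_coordinates \<Lambda>' a' b' U' V' by fact
  let ?S = "{x + y | x y. x \<in> \<Lambda> \<and> y \<in> \<Lambda>'}"
  have S: "add_subgroup ?S"
    by (rule add_subgroup_sum [OF P.subgroup P'.subgroup])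
  have "\<Lambda> \<subseteq> ?S" "\<Lambda>' \<subseteq> ?S"
    using add_subgroup_mem(1) [OF P.subgroup] add_subgroup_mem(1) [OF P'.subgroup]
    by (metis (mono_tags, lifting) add.right_neutral add.left_neutral mem_Collect_eq subsetI)+
  note sub = this
  define w w' where "w = P.pt 0 1" and "w' = P'.pt 0 1"
  have w: "w \<in> \<Lambda>" "w' \<in> \<Lambda>'" by (auto simp: w_def w'_def intro: P.pt_mem P'.pt_mem)
  have one: "of_real (1 / a) \<in> \<Lambda>" "of_real (1 / a') \<in> \<Lambda>'"
    using P.pt_mem [of 1 0] P'.pt_mem [of 1 0] by (simp_all add: par_pt_def complex_of_real_def)
  have cancel: "x = of_real (r / (of_nat N * a))" if "of_nat N * x = of_real (r / a)" for x :: complex and r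
  proof -
    have "x = of_nat N * x / of_nat N" using N(1) by simp
    also have "\<dots> = of_real (r / (of_nat N * a))" unfolding that by (simp add: mult.commute)
    finally show ?thesis .
  qed
  obtain p where "of_nat N * of_real (1 / a') = (of_real (of_int p / a) :: complex)"
    using P.mem_real [OF N(2) [OF one(2)]] by auto
  then have p: "of_real (1 / a') = (of_real (of_int p / (of_nat N * a)) :: complex)"
    by (rule cancel)
  have "of_nat N * w' - of_nat N * w \<in> \<Lambda>"
    using add_subgroup_mem(4) [OF P.subgroup N(2) [OF w(2)]]
      add_subgroup_of_int_mult [OF P.subgroup w(1), of "int N"] by simp
  then obtain q where "of_nat N * w' - of_nat N * w = of_real (of_int q / a)"
    by (rule P.mem_real) (simp add: w_def w'_def)
  then have q: "w' - w = of_real (of_int q / (of_nat N * a))"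
    by (intro cancel) (simp add: right_diff_distrib)
  define g where "g = gcd (int N) (gcd p q)"
  have g: "g > 0" "g dvd int N" "g dvd p" "g dvd q"
    using N(1) by (auto simp: g_def intro: dvd_trans [OF gcd_dvd2])
  define d where "d = of_int g / (of_nat N * a)"
  obtain x y where xy: "x * p + y * q = gcd p q" using bezout_int by metis
  obtain s t where "s * int N + t * gcd p q = g" using bezout_int unfolding g_def by metis
  then have bezout: "of_int g = real_of_int (s * int N + t * x * p + t * y * q)"
    unfolding xy [symmetric] by (simp add: algebra_simps)
  show thesis
  proof (rule that)
    show "d > 0" using g N P.a_pos by (simp add: d_def)
    show "?S = {of_int m * of_real d + of_int n * par_pt a b 0 1 | m n. True}"
    proof (intro equalityI subsetI)
      fix z assume "z \<in> ?S"
      then obtain i j k l where z: "z = P.pt (of_int i) (of_int j) + P'.pt (of_int k) (of_int l)"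
        unfolding P.\<Lambda>_eq P'.\<Lambda>_eq by blast
      have "P.pt (of_int i) (of_int j) = of_int i * of_real (1 / a) + of_int j * w"
        "P'.pt (of_int k) (of_int l) = of_int k * of_real (1 / a') + of_int l * w'"
        by (simp_all add: w_def w'_def complex_eq_iff diff_divide_distrib)
      then have "z = of_int i * of_real (1 / a) + of_int k * of_real (1 / a') + of_int l * (w' - w)
          + of_int (j + l) * w"
        by (simp add: z algebra_simps)
      also have "\<dots> = of_real (of_int (i * int N + k * p + l * q) / (of_nat N * a)) + of_int (j + l) * w"
        unfolding p q using N(1) P.a_pos by (simp add: field_simps)
      also have "of_int (i * int N + k * p + l * q) / (of_nat N * a)
          = of_int ((i * int N + k * p + l * q) div g) * d"
      proof -
        have "g dvd i * int N + k * p + l * q" using g by (intro dvd_add dvd_mult)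
        then have "(i * int N + k * p + l * q) div g * g = i * int N + k * p + l * q" by simp
        then show ?thesis unfolding d_def by (metis of_int_mult times_divide_eq_right)
      qed
      finally have "z = of_int ((i * int N + k * p + l * q) div g) * of_real d + of_int (j + l) * P.pt 0 1"
        by (simp only: w_def of_real_mult of_real_of_int_eq)
      then show "z \<in> {of_int m * of_real d + of_int n * par_pt a b 0 1 | m n. True}" by blast
    next
      fix z assume "z \<in> {of_int m * of_real d + of_int n * par_pt a b 0 1 | m n. True}"
      then obtain m n where z: "z = of_int m * of_real d + of_int n * w" by (auto simp: w_def)
      have "of_real d = of_int s * of_real (1 / a) + of_int (t * x) * of_real (1 / a')
          + of_int (t * y) * (w' - w)"
        unfolding p q d_def bezout using N(1) P.a_pos by (simp add: field_simps)
      moreover have "of_real (1 / a) \<in> ?S" "of_real (1 / a') \<in> ?S" "w \<in> ?S" "w' \<in> ?S"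
        using one w sub by blast+
      ultimately show "z \<in> ?S"
        unfolding z
        by (simp only:) (intro add_subgroup_mem(2) [OF S] add_subgroup_of_int_mult [OF S]
            add_subgroup_mem(4) [OF S])
    qed
  qed
qed

text \<open>The restrictions of \<open>\<phi>\<close> to the two coordinate axes are \<open>c \<xi>\<close> and \<open>c \<eta>\<close>, which expresses the
  marking through \<open>u\<close> and \<open>v\<close>. If \<open>u\<close> were \<open>0\<close>, so would be \<open>\<xi>\<close>.\<close>

lemma associated_parabolicE:
  assumes E: "triangular_ell (L, \<xi>, \<eta>)" and assoc: "associated_parabolic (L, \<xi>, \<eta>) c (\<Lambda>, \<phi>)"
  obtains a b U V where "parabolic_coordinates \<Lambda> a b U V" "c \<noteq> 0" "\<Lambda> = (*) c ` L"
    "\<And>r. r \<in> \<rat> \<Longrightarrow> \<xi> (coset \<int> r) = coset L (par_pt a b (U r) 0 / c)"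
    "\<And>t. t \<in> \<rat> \<Longrightarrow> \<eta> (coset \<int> t) = coset L (par_pt a b (V t) t / c)"
    "\<And>r t. r \<in> \<rat> \<Longrightarrow> t \<in> \<rat> \<Longrightarrow> \<phi> (coset \<int> r, coset \<int> t) = coset \<Lambda> (par_pt a b (U r + V t) t)"
    "\<phi> \<in> extensional (carrier QZ2)"
proof -
  have L: "lattice_in_complex L" and TE: "\<xi> \<in> TE L" "\<eta> \<in> TE L"
    and nonzero: "\<xi> \<noteq> (\<lambda>x\<in>carrier QZ. \<one>\<^bsub>ell_tor L\<^esub>)"
    using E by auto
  note H = lattice_add_subgroup [OF L]
  have c: "c \<noteq> 0" and \<Lambda>_cL: "\<Lambda> = (*) c ` L"
    and \<phi>_c: "\<phi> = (\<lambda>p\<in>carrier QZ2. (*) c ` ((\<lambda>(x, y)\<in>carrier QZ2. \<xi> x \<otimes>\<^bsub>ell L\<^esub> \<eta> y) p))"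
    and par: "parabolic (\<Lambda>, \<phi>)"
    using assoc by (auto simp: associated_parabolic_def)
  obtain a b u v where a: "a > 0" and uv: "u \<in> Zhat" "v \<in> Zhat"
    and \<Lambda>_alpha: "\<Lambda> = inv_into UNIV (alpha a b) ` Lambda0"
    and \<phi>_alpha: "\<phi> = (\<lambda>p\<in>carrier QZ2. inv_into UNIV (alpha a b) ` rho u v p)"
    using par by auto
  have \<Lambda>_eq: "\<Lambda> = {par_pt a b (of_int m) (of_int n) | m n. True}"
    using \<Lambda>_alpha parabolic_lattice_eq [of a b] a by simp
  have \<Lambda>: "add_subgroup \<Lambda>"
    unfolding \<Lambda>_cL by (rule add_subgroup_mult_image [OF H])
  have hom: "u \<in> hom (add_grp \<rat> Mod \<int>) (add_grp \<rat> Mod \<int>)" "v \<in> hom (add_grp \<rat> Mod \<int>) (add_grp \<rat> Mod \<int>)"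
    "\<xi> \<in> hom (add_grp \<rat> Mod \<int>) (add_grp (rat_mult L) Mod L)"
    "\<eta> \<in> hom (add_grp \<rat> Mod \<int>) (add_grp (rat_mult L) Mod L)"
    using uv TE by (auto simp: Zhat_def TE_def Hom_def QZ_def ell_tor_def)
  have zero: "0 \<in> rat_mult L" using subset_rat_mult add_subgroup_mem(1) [OF H] by blast
  note lift = quot_hom_lift [OF _ add_subgroup_Ints _ add_subgroup_Rats]
  obtain U where U: "U 0 = 0" "\<And>r. r \<in> \<rat> \<Longrightarrow> U r \<in> \<rat> \<and> u (coset \<int> r) = coset \<int> (U r)"
    "\<And>r s. r \<in> \<rat> \<Longrightarrow> s \<in> \<rat> \<Longrightarrow> U (r + s) - U r - U s \<in> \<int>"
    using lift [OF hom(1) add_subgroup_Ints Rats_0] by metis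
  obtain V where V: "V 0 = 0" "\<And>r. r \<in> \<rat> \<Longrightarrow> V r \<in> \<rat> \<and> v (coset \<int> r) = coset \<int> (V r)"
    "\<And>r s. r \<in> \<rat> \<Longrightarrow> s \<in> \<rat> \<Longrightarrow> V (r + s) - V r - V s \<in> \<int>"
    using lift [OF hom(2) add_subgroup_Ints Rats_0] by metis
  obtain X where X: "X 0 = 0" "\<And>r. r \<in> \<rat> \<Longrightarrow> X r \<in> rat_mult L \<and> \<xi> (coset \<int> r) = coset L (X r)"
    using lift [OF hom(3) H zero] by metis
  obtain Y where Y: "Y 0 = 0" "\<And>r. r \<in> \<rat> \<Longrightarrow> Y r \<in> rat_mult L \<and> \<eta> (coset \<int> r) = coset L (Y r)"
    using lift [OF hom(4) H zero] by metis
  have QZ2: "(coset \<int> r, coset \<int> t) \<in> carrier QZ2" if "r \<in> \<rat>" "t \<in> \<rat>" for r t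
    using that by (simp add: QZ2_def QZ_carrier)
  have \<phi>_XY: "\<phi> (coset \<int> r, coset \<int> t) = coset \<Lambda> (c * (X r + Y t))" if "r \<in> \<rat>" "t \<in> \<rat>" for r t
    using that X(2) Y(2) QZ2
    by (simp add: \<phi>_c \<Lambda>_cL mult_image_coset [OF c] ell_def quot_mult [OF H])
  have \<phi>_UV: "\<phi> (coset \<int> r, coset \<int> t) = coset \<Lambda> (par_pt a b (U r + V t) t)" if "r \<in> \<rat>" "t \<in> \<rat>" for r t
  proof -
    have "u (coset \<int> r) \<otimes>\<^bsub>QZ\<^esub> v (coset \<int> t) = coset \<int> (U r + V t)"
      using that U(2) V(2) by (simp add: QZ_mult)
    then have "rho u v (coset \<int> r, coset \<int> t)
        = {of_real r' * e1 + of_real t' * e2 | r' t'. r' - (U r + V t) \<in> \<int> \<and> t' - t \<in> \<int>}"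
      by (simp add: rho_def mem_coset)
    moreover have "inv_into UNIV (alpha a b) (of_real r' * e1 + of_real t' * e2) = par_pt a b r' t'"
      for r' t'
      using a by (simp add: inv_alpha e1_def e2_def)
    ultimately have "\<phi> (coset \<int> r, coset \<int> t)
        = {par_pt a b r' t' | r' t'. r' - (U r + V t) \<in> \<int> \<and> t' - t \<in> \<int>}"
      using QZ2 [OF that] by (simp only: \<phi>_alpha restrict_apply' image_Collect2)
    also have "\<dots> = coset \<Lambda> (par_pt a b (U r + V t) t)"
    proof (intro equalityI subsetI)
      fix z assume "z \<in> {par_pt a b r' t' | r' t'. r' - (U r + V t) \<in> \<int> \<and> t' - t \<in> \<int>}"
      then obtain r' t' m n where "z = par_pt a b r' t'" "r' - (U r + V t) = of_int m" "t' - t = of_int n"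
        by (auto elim!: Ints_cases)
      then show "z \<in> coset \<Lambda> (par_pt a b (U r + V t) t)"
        by (auto simp: mem_coset par_pt_diff \<Lambda>_eq)
    next
      fix z assume "z \<in> coset \<Lambda> (par_pt a b (U r + V t) t)"
      then obtain m n where "z - par_pt a b (U r + V t) t = par_pt a b (of_int m) (of_int n)"
        by (auto simp: mem_coset \<Lambda>_eq)
      then have "z = par_pt a b (of_int m + (U r + V t)) (of_int n + t)"
        by (metis diff_add_cancel par_pt_add)
      moreover have "of_int m + (U r + V t) - (U r + V t) \<in> \<int>" "of_int n + t - t \<in> \<int>" by simp_all
      ultimately show "z \<in> {par_pt a b r' t' | r' t'. r' - (U r + V t) \<in> \<int> \<and> t' - t \<in> \<int>}" by blast
    qed
    finally show ?thesis .
  qed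
  have div: "coset L x = coset L (z / c)" if "coset \<Lambda> (c * x) = coset \<Lambda> z" for x z
  proof -
    have "c * x - z \<in> (*) c ` L"
      using that coset_eq_iff [OF \<Lambda>] unfolding \<Lambda>_cL by metis
    then obtain y where "y \<in> L" "c * x - z = c * y" by blast
    then have "x - z / c \<in> L" using c by (simp add: field_simps)
    then show ?thesis by (simp add: coset_eq_iff H)
  qed
  have \<xi>: "\<xi> (coset \<int> r) = coset L (par_pt a b (U r) 0 / c)" if r: "r \<in> \<rat>" for r
    using \<phi>_XY [OF r Rats_0] \<phi>_UV [OF r Rats_0] X(2) [OF r] V(1) Y(1) div [of "X r" "par_pt a b (U r) 0"]
    by simp
  have \<eta>: "\<eta> (coset \<int> t) = coset L (par_pt a b (V t) t / c)" if t: "t \<in> \<rat>" for t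
    using \<phi>_XY [OF Rats_0 t] \<phi>_UV [OF Rats_0 t] Y(2) [OF t] U(1) X(1) div [of "Y t" "par_pt a b (V t) t"]
    by simp
  have U_nonzero: "\<exists>r\<in>\<rat>. U r \<notin> \<int>"
  proof (rule ccontr)
    assume "\<not> (\<exists>r\<in>\<rat>. U r \<notin> \<int>)"
    then have int: "U r \<in> \<int>" if "r \<in> \<rat>" for r using that by blast
    have "\<xi> x = L" if x: "x \<in> carrier QZ" for x
    proof -
      obtain r where r: "r \<in> \<rat>" "x = coset \<int> r" using x unfolding QZ_carrier by blast
      obtain m where m: "U r = of_int m" using int [OF r(1)] by (auto elim: Ints_cases)
      have "par_pt a b (of_int m) (of_int 0) \<in> \<Lambda>" unfolding \<Lambda>_eq by blast
      then have "par_pt a b (U r) 0 / c \<in> L" using c by (auto simp: m \<Lambda>_cL)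
      then show ?thesis using \<xi> [OF r(1)] r(2) by (simp add: coset_eq_subgroup_iff H)
    qed
    moreover have "\<xi> \<in> extensional (carrier QZ)" using TE by (auto simp: TE_def Hom_def)
    ultimately have "\<xi> = (\<lambda>x\<in>carrier QZ. \<one>\<^bsub>ell_tor L\<^esub>)"
      by (auto intro!: extensionalityI [of _ "carrier QZ"] simp: ell_tor_def)
    with nonzero show False ..
  qed
  have "parabolic_coordinates \<Lambda> a b U V"
    by unfold_locales (rule a \<Lambda>_eq U(1) V(1) U(3) V(3) U_nonzero; assumption)+
  moreover have "\<phi> \<in> extensional (carrier QZ2)" by (simp add: \<phi>_c)
  ultimately show thesis using that c \<Lambda>_cL \<xi> \<eta> \<phi>_UV by metis
qed

lemma induced_id_coset:
  assumes "add_subgroup L" "add_subgroup L'" "L \<subseteq> L'"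
  shows "induced_id L L' (coset L z) = coset L' z"
proof -
  have "induced_id L L' = quot_map L L' (\<lambda>z. z)"
    by (simp add: induced_id_def quot_map_def ell_def)
  moreover have "Modules.additive (\<lambda>z :: complex. z)" by unfold_locales simp
  ultimately show ?thesis using quot_map_coset [OF assms(1,2), of "\<lambda>z. z"] assms(3) by simp
qed

text \<open>Characters of \<open>\<complex>/S\<close> lift to real linear functionals \<open>\<kappa>\<close> integral on \<open>S\<close>. Such a character annihilates
  \<open>\<xi>\<close> exactly when \<open>\<kappa>\<close> vanishes on \<open>\<real>\<close>, because \<open>u\<close> is not torsion; then \<open>\<kappa>\<close> is an integral
  multiple of the second coordinate, and the second coordinate of \<open>\<eta>(t)\<close> is \<open>t\<close>.\<close>

lemma (in parabolic_coordinates) triangular_overlattice: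
  assumes d: "d > 0" and S: "S = {of_int m * of_real d + of_int n * pt 0 1 | m n. True}"
    and sub: "\<Lambda> \<subseteq> S" and TE: "\<xi> \<in> TE S" "\<eta> \<in> TE S"
    and \<xi>: "\<And>r. r \<in> \<rat> \<Longrightarrow> \<xi> (coset \<int> r) = coset S (pt (U r) 0)"
    and \<eta>: "\<And>t. t \<in> \<rat> \<Longrightarrow> \<eta> (coset \<int> t) = coset S (pt (V t) t)"
  shows "triangular_ell (S, \<xi>, \<eta>)"
proof -
  have "Im (cnj (of_real d) * pt 0 1) \<noteq> 0" using d by simp
  then have lattice: "lattice_in_complex S"
    unfolding lattice_in_complex_def conj_assoc [symmetric] independent_complex_iff using S by blast
  note H = lattice_add_subgroup [OF lattice]
  have mem_Im: "Im z \<in> \<int>" if "z \<in> S" for z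
    using that unfolding S by auto
  have mem_real: "\<exists>m::int. x = of_int m * d" if "of_real x \<in> S" for x
    using that unfolding S by (auto simp: complex_eq_iff)
  have gens: "of_real d \<in> S" "pt 0 1 \<in> S"
  proof -
    have "of_real d = of_int 1 * of_real d + of_int 0 * pt 0 1"
      "pt 0 1 = of_int 0 * of_real d + of_int 1 * pt 0 1" by simp_all
    then show "of_real d \<in> S" "pt 0 1 \<in> S" unfolding S by blast+
  qed
  have pt_real: "pt x 0 = of_real (x / a)" for x
    by (simp add: complex_eq_iff)
  obtain k where k: "1 / a = of_int k * d"
    using mem_real [of "1 / a"] pt_mem [of 1 0] sub by (auto simp: pt_real)
  have "k \<noteq> 0" using k a_pos by auto
  have pt_kd: "pt x 0 = of_real (of_int k * x * d)" for x
  proof -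
    have "x / a = x * (1 / a)" by simp
    then show ?thesis unfolding pt_real k by (simp add: mult_ac)
  qed
  have "\<xi> \<noteq> (\<lambda>x\<in>carrier QZ. \<one>\<^bsub>ell_tor S\<^esub>)"
  proof
    assume "\<xi> = (\<lambda>x\<in>carrier QZ. \<one>\<^bsub>ell_tor S\<^esub>)"
    then have trivial: "coset S (pt (U r) 0) = S" if "r \<in> \<rat>" for r
      using \<xi> [OF that] that by (simp add: QZ_carrier ell_tor_def)
    have "of_int k * U r \<in> \<int>" if r: "r \<in> \<rat>" for r
    proof -
      have "of_real (of_int k * U r * d) \<in> S"
        using trivial [OF r] by (simp only: coset_eq_subgroup_iff [OF H] pt_kd)
      then obtain m :: int where "of_int k * U r * d = of_int m * d" using mem_real by blast
      then show ?thesis using d by simp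
    qed
    then show False using U_torsion_free \<open>k \<noteq> 0\<close> by blast
  qed
  moreover have "T_map \<psi> \<eta> \<in> int_Zhat" if \<psi>: "\<psi> \<in> perp S \<xi>" for \<psi>
  proof -
    have "\<psi> \<in> characters S" and perp: "T_map \<psi> \<xi> = (\<lambda>x\<in>carrier QZ. \<one>\<^bsub>QZ\<^esub>)"
      using \<psi> by (auto simp: perp_def)
    then obtain \<kappa> where \<kappa>: "linear \<kappa>" "\<And>z. \<psi> (coset S z) = coset \<int> (\<kappa> z)"
      using character_lift [OF H] by blast
    have \<kappa>_int: "\<kappa> z \<in> \<int>" if "z \<in> S" for z
    proof -
      have "coset S z = S" using that by (simp add: coset_eq_subgroup_iff H)
      then have "coset \<int> (\<kappa> z) = \<int>"
        using \<kappa>(2) [of z] \<kappa>(2) [of 0] linear_0 [OF \<kappa>(1)] by simp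
      then show ?thesis by (simp add: coset_eq_subgroup_iff add_subgroup_Ints)
    qed
    have \<kappa>_real: "\<kappa> (of_real x) = x * \<kappa> 1" for x
      using linear_scale [OF \<kappa>(1), of x 1] by (simp add: of_real_def)
    obtain j where j: "\<kappa> (of_real d) = of_int j" using \<kappa>_int [OF gens(1)] by (auto elim: Ints_cases)
    have "of_int (k * j) * U r \<in> \<int>" if r: "r \<in> \<rat>" for r
    proof -
      have "coset \<int> (\<kappa> (pt (U r) 0)) = \<int>"
        using fun_cong [OF perp, of "coset \<int> r"] r by (simp add: T_map_coset \<xi> \<kappa> QZ_carrier QZ_one)
      then have "\<kappa> (pt (U r) 0) \<in> \<int>" by (simp add: coset_eq_subgroup_iff add_subgroup_Ints)
      moreover have "\<kappa> (pt (U r) 0) = of_int k * U r * \<kappa> (of_real d)"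
        unfolding pt_kd by (simp only: \<kappa>_real mult_ac)
      ultimately show ?thesis by (simp add: j mult_ac)
    qed
    then have "k * j = 0" by (rule U_torsion_free)
    then have "d * \<kappa> 1 = 0" using j \<open>k \<noteq> 0\<close> by (simp add: \<kappa>_real)
    then have \<kappa>_1: "\<kappa> 1 = 0" using d by simp
    obtain n where n: "\<kappa> (pt 0 1) = of_int n" using \<kappa>_int [OF gens(2)] by (auto elim: Ints_cases)
    have "\<kappa> (pt x y) = of_int n * y" for x y
    proof -
      have "pt x y = of_real (x / a) + y *\<^sub>R pt 0 1" by (simp add: complex_eq_iff diff_divide_distrib)
      then show ?thesis
        by (simp add: linear_add [OF \<kappa>(1)] linear_scale [OF \<kappa>(1)] \<kappa>_real \<kappa>_1 n del: of_real_divide)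
    qed
    then have "T_map \<psi> \<eta> (coset \<int> t) = coset \<int> (of_int n * t)" if "t \<in> \<rat>" for t
      using that by (simp add: T_map_coset \<eta> \<kappa>)
    then have "T_map \<psi> \<eta> = (\<lambda>x\<in>carrier QZ. x [^]\<^bsub>QZ\<^esub> n)"
      by (intro extensionalityI [of _ "carrier QZ"])
         (auto simp: QZ_carrier QZ_int_pow T_map_def)
    then show ?thesis unfolding int_Zhat_def by blast
  qed
  moreover have "\<exists>\<psi>\<in>perp S \<xi>. (\<lambda>x\<in>carrier QZ. x [^]\<^bsub>QZ\<^esub> n) = T_map \<psi> \<eta>" for n :: int
  proof -
    define \<kappa> where "\<kappa> z = - of_int n * Im z" for z
    have \<kappa>: "linear \<kappa>" by (rule linearI) (simp_all add: \<kappa>_def algebra_simps)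
    have "\<kappa> ` S \<subseteq> \<int>" using mem_Im by (auto simp: \<kappa>_def)
    note character = quot_map_character [OF H \<kappa> this]
    have add: "Modules.additive \<kappa>" using \<kappa> by (simp add: Modules.additive_def linear_add)
    note coset = quot_map_coset [OF H add_subgroup_Ints add \<open>\<kappa> ` S \<subseteq> \<int>\<close>]
    have "T_map (quot_map S \<int> \<kappa>) \<xi> = (\<lambda>x\<in>carrier QZ. \<one>\<^bsub>QZ\<^esub>)"
      by (intro extensionalityI [of _ "carrier QZ"])
         (auto simp: QZ_carrier QZ_one T_map_coset \<xi> coset \<kappa>_def, simp_all add: T_map_def compose_def flip: QZ_carrier)
    then have "quot_map S \<int> \<kappa> \<in> perp S \<xi>"
      using character by (simp add: perp_def)
    moreover have "T_map (quot_map S \<int> \<kappa>) \<eta> = (\<lambda>x\<in>carrier QZ. x [^]\<^bsub>QZ\<^esub> n)"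
      by (intro extensionalityI [of _ "carrier QZ"])
         (auto simp: QZ_carrier QZ_int_pow T_map_coset \<eta> coset \<kappa>_def, simp_all add: T_map_def compose_def flip: QZ_carrier)
    ultimately show ?thesis by metis
  qed
  ultimately show ?thesis
    using lattice TE by (auto simp: int_Zhat_def)
qed

section \<open>Isogenies of triangular elliptic curves and commensurability\<close>

text \<open>A marked elliptic curve \<open>(L, \<xi>, \<eta>)\<close> together with the coordinates of its parabolic \<open>\<rat>\<close>-lattice
  \<open>(\<Lambda>, \<phi>)\<close>; bundling both allows two curves to be compared by two interpretations.\<close>

locale parabolic_ell = parabolic_coordinates \<Lambda> a b U V for \<Lambda> a b U V +
  fixes L :: "complex set" and \<xi> \<eta> :: "real set \<Rightarrow> complex set"
    and c :: complex and \<phi> :: "real set \<times> real set \<Rightarrow> complex set"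
  assumes lattice_L: "lattice_in_complex L" and \<xi>_TE: "\<xi> \<in> TE L" and \<eta>_TE: "\<eta> \<in> TE L"
    and c_nonzero: "c \<noteq> 0" and \<Lambda>_image: "\<Lambda> = (*) c ` L"
    and \<xi>_coset: "\<And>r. r \<in> \<rat> \<Longrightarrow> \<xi> (coset \<int> r) = coset L (pt (U r) 0 / c)"
    and \<eta>_coset: "\<And>t. t \<in> \<rat> \<Longrightarrow> \<eta> (coset \<int> t) = coset L (pt (V t) t / c)"
    and \<phi>_coset: "\<And>r t. r \<in> \<rat> \<Longrightarrow> t \<in> \<rat> \<Longrightarrow> \<phi> (coset \<int> r, coset \<int> t) = coset \<Lambda> (pt (U r + V t) t)"
    and \<phi>_extensional: "\<phi> \<in> extensional (carrier QZ2)"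
begin

lemma subgroup_L: "add_subgroup L"
  using lattice_L by (rule lattice_add_subgroup)

text \<open>In terms of \<open>d = c / l\<close>, a triangular isogeny lifting to multiplication by \<open>l\<close> identifies the target
  with \<open>\<complex> / d L''\<close> in such a way that the isogeny becomes the projection from \<open>\<complex> / \<Lambda>\<close>.\<close>

lemma triangular_isogenyE:
  assumes f: "triangular_isogeny (L, \<xi>, \<eta>) (L'', \<xi>'', \<eta>'') f" and L'': "lattice_in_complex L''"
  obtains d N where "d \<noteq> 0" "N > 0" "\<And>z. f (coset L z) = coset L'' (c * z / d)"
    "\<Lambda> \<subseteq> (*) d ` L''" "\<And>z. z \<in> (*) d ` L'' \<Longrightarrow> of_nat N * z \<in> \<Lambda>"
    "\<And>r. r \<in> \<rat> \<Longrightarrow> \<xi>'' (coset \<int> r) = coset L'' (pt (U r) 0 / d)"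
    "\<And>t. t \<in> \<rat> \<Longrightarrow> \<eta>'' (coset \<int> t) = coset L'' (pt (V t) t / d)"
proof -
  obtain l N where l: "\<And>z. f (coset L z) = coset L'' (l * z)" "l \<noteq> 0"
    and N: "N > 0" "\<And>z. z \<in> L'' \<Longrightarrow> of_nat N * z \<in> (*) l ` L"
    using isogenyE [OF lattice_L L''] f by (metis triangular_isogeny.simps)
  note sub = isogeny_mult_subset [OF subgroup_L lattice_add_subgroup [OF L''] l(1)]
  show thesis
  proof (rule that [of "c / l" N])
    show "c / l \<noteq> 0" "N > 0" using l(2) c_nonzero N(1) by simp_all
    show f_l: "f (coset L z) = coset L'' (c * z / (c / l))" for z
      using l c_nonzero by (simp add: mult.commute)
    show "\<Lambda> \<subseteq> (*) (c / l) ` L''"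
    proof
      fix z assume "z \<in> \<Lambda>"
      then obtain y where "y \<in> L" "z = c * y" unfolding \<Lambda>_image by blast
      then have "z = c / l * (l * y)" "l * y \<in> L''" using l(2) sub by auto
      then show "z \<in> (*) (c / l) ` L''" by blast
    qed
    show "of_nat N * z \<in> \<Lambda>" if z: "z \<in> (*) (c / l) ` L''" for z
    proof -
      obtain y where y: "y \<in> L''" "z = c / l * y" using z by blast
      obtain x where x: "x \<in> L" "of_nat N * y = l * x" using N(2) [OF y(1)] by blast
      have "of_nat N * z = c / l * (of_nat N * y)" using y(2) by simp
      also have "\<dots> = c * x" unfolding x(2) using l(2) by simp
      finally show ?thesis using x(1) unfolding \<Lambda>_image by blast
    qed
    show "\<xi>'' (coset \<int> r) = coset L'' (pt (U r) 0 / (c / l))" if "r \<in> \<rat>" for r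
    proof -
      have "\<xi>'' (coset \<int> r) = f (\<xi> (coset \<int> r))" using f that by (auto simp: T_map_coset)
      then show ?thesis using that l(1) by (simp add: \<xi>_coset mult.commute)
    qed
    show "\<eta>'' (coset \<int> t) = coset L'' (pt (V t) t / (c / l))" if "t \<in> \<rat>" for t
    proof -
      have "\<eta>'' (coset \<int> t) = f (\<eta> (coset \<int> t))" using f that by (auto simp: T_map_coset)
      then show ?thesis using that l(1) by (simp add: \<eta>_coset mult.commute)
    qed
  qed
qed

lemma transport_eq:
  assumes f: "\<And>z. f (coset L z) = coset L' (c * z / c')" and c': "c' \<noteq> 0"
    and sub: "\<Lambda> \<subseteq> (*) c' ` L'" and L': "add_subgroup L'"
  shows "transport \<Lambda> c c' f = induced_id \<Lambda> ((*) c' ` L')"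
proof (rule quot_hom_eqI)
  show "transport \<Lambda> c c' f \<in> extensional (carrier (add_grp UNIV Mod \<Lambda>))"
    "induced_id \<Lambda> ((*) c' ` L') \<in> extensional (carrier (add_grp UNIV Mod \<Lambda>))"
    by (simp_all add: transport_def induced_id_def ell_def)
  fix z
  have "(*) (inverse c) ` \<Lambda> = L" using c_nonzero by (simp add: \<Lambda>_image image_image mult.assoc [symmetric])
  then have "(*) (inverse c) ` coset \<Lambda> z = coset L (inverse c * z)"
    using c_nonzero mult_image_coset [of "inverse c" \<Lambda> z] by simp
  then have "transport \<Lambda> c c' f (coset \<Lambda> z) = (*) c' ` coset L' (c * (inverse c * z) / c')"
    by (simp only: transport_def ell_def quot_carrier restrict_apply' rangeI f)
  also have "\<dots> = coset ((*) c' ` L') z"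
  proof -
    have "c * (inverse c * z) = z" using c_nonzero by (simp add: field_simps)
    then have "(*) c' ` coset L' (c * (inverse c * z) / c') = (*) c' ` coset L' (z / c')"
      by (simp only:)
    then show ?thesis using c' by (simp add: mult_image_coset)
  qed
  also have "\<dots> = induced_id \<Lambda> ((*) c' ` L') (coset \<Lambda> z)"
    by (rule induced_id_coset [symmetric, OF subgroup add_subgroup_mult_image [OF L'] sub])
  finally show "transport \<Lambda> c c' f (coset \<Lambda> z) = induced_id \<Lambda> ((*) c' ` L') (coset \<Lambda> z)" .
qed

end

lemma associated_parabolic_ell:
  assumes "triangular_ell (L, \<xi>, \<eta>)" "associated_parabolic (L, \<xi>, \<eta>) c (\<Lambda>, \<phi>)"
  obtains a b U V where "parabolic_ell \<Lambda> a b U V L \<xi> \<eta> c \<phi>"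
proof (rule associated_parabolicE [OF assms])
  fix a b U V
  assume "parabolic_coordinates \<Lambda> a b U V" "c \<noteq> 0" "\<Lambda> = (*) c ` L"
    "\<And>r. r \<in> \<rat> \<Longrightarrow> \<xi> (coset \<int> r) = coset L (par_pt a b (U r) 0 / c)"
    "\<And>t. t \<in> \<rat> \<Longrightarrow> \<eta> (coset \<int> t) = coset L (par_pt a b (V t) t / c)"
    "\<And>r t. r \<in> \<rat> \<Longrightarrow> t \<in> \<rat> \<Longrightarrow> \<phi> (coset \<int> r, coset \<int> t) = coset \<Lambda> (par_pt a b (U r + V t) t)"
    "\<phi> \<in> extensional (carrier QZ2)"
  then have "parabolic_ell \<Lambda> a b U V L \<xi> \<eta> c \<phi>"
    using assms(1) by (intro parabolic_ell.intro parabolic_ell_axioms.intro) auto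
  then show thesis by (rule that)
qed

text \<open>The two isogenies identify their common target with \<open>\<complex> / d L\<close> and with \<open>\<complex> / d' L\<close>. The ratio of the
  scalings is \<open>1\<close> by rigidity, applied to \<open>\<nu> = N d / d'\<close>, where \<open>N\<close> brings everything from \<open>d L\<close>
  back into \<open>\<Lambda>\<close>.\<close>

lemma common_target_scaling:
  assumes "parabolic_coordinates \<Lambda> a b U V" and "parabolic_coordinates \<Lambda>' a' b' U' V'"
    and L: "add_subgroup L" and d: "d \<noteq> 0" and d': "d' \<noteq> 0"
    and N: "N > 0" "\<And>z. z \<in> (*) d ` L \<Longrightarrow> of_nat N * z \<in> \<Lambda>"
    and sub: "\<Lambda>' \<subseteq> (*) d' ` L"
    and \<xi>: "\<And>r. r \<in> \<rat> \<Longrightarrow> coset L (par_pt a b (U r) 0 / d) = coset L (par_pt a' b' (U' r) 0 / d')"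
    and \<eta>: "\<And>t. t \<in> \<rat> \<Longrightarrow> coset L (par_pt a b (V t) t / d) = coset L (par_pt a' b' (V' t) t / d')"
  shows "d = d'"
proof -
  define \<nu> where "\<nu> = of_nat N * d / d'"
  have diff: "of_nat N * x - \<nu> * y \<in> \<Lambda>" if "coset L (x / d) = coset L (y / d')" for x y
  proof -
    have "x / d - y / d' \<in> L" using that by (simp add: coset_eq_iff L)
    then have "of_nat N * (d * (x / d - y / d')) \<in> \<Lambda>" by (intro N(2) imageI)
    then show ?thesis using d by (simp add: \<nu>_def right_diff_distrib mult.assoc)
  qed
  have "\<nu> = of_nat N"
  proof (rule parabolic_rigidity [OF assms(1,2)])
    fix z assume "z \<in> \<Lambda>'"
    then obtain y where y: "y \<in> L" "z = d' * y" using sub by blast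
    have "\<nu> * z = of_nat N * (d * y)" using d' by (simp add: \<nu>_def y(2))
    also have "\<dots> \<in> \<Lambda>" using y(1) by (intro N(2) imageI)
    finally show "\<nu> * z \<in> \<Lambda>" .
  qed (use diff \<xi> \<eta> in blast)+
  then show ?thesis using N(1) d' by (simp add: \<nu>_def field_simps)
qed

text \<open>For the first claim the target \<open>E'\<close> is compared with itself: it is scaled by \<open>d\<close> through the isogeny
  and by \<open>c'\<close> through its own \<open>\<rat>\<close>-lattice.\<close>

theorem proposition6p3:
  fixes E E' :: marked_ell
    and \<Lambda> \<Lambda>' :: "complex set"
    and \<phi> \<phi>' :: "real set \<times> real set \<Rightarrow> complex set"
    and c c' :: complex
  assumes "triangular_ell E" and "triangular_ell E'"
    and "associated_parabolic E c (\<Lambda>, \<phi>)"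
    and "associated_parabolic E' c' (\<Lambda>', \<phi>')"
  shows "(\<forall>f. triangular_isogeny E E' f \<longrightarrow>
            \<Lambda> \<subseteq> \<Lambda>' \<and>
            transport \<Lambda> c c' f = induced_id \<Lambda> \<Lambda>' \<and>
            \<phi>' = compose (carrier QZ2) (transport \<Lambda> c c' f) \<phi>) \<and>
         (commensurable (\<Lambda>, \<phi>) (\<Lambda>', \<phi>') \<longleftrightarrow>
            (\<exists>E'' f f'. triangular_ell E'' \<and>
               triangular_isogeny E E'' f \<and> triangular_isogeny E' E'' f'))"
proof -
  obtain L \<xi> \<eta> L' \<xi>' \<eta>' where E: "E = (L, \<xi>, \<eta>)" and E': "E' = (L', \<xi>', \<eta>')"
    by (metis prod_cases3)
  obtain a b U V where "parabolic_ell \<Lambda> a b U V L \<xi> \<eta> c \<phi>"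
    using associated_parabolic_ell assms(1,3) unfolding E by blast
  then interpret P: parabolic_ell \<Lambda> a b U V L \<xi> \<eta> c \<phi> .
  obtain a' b' U' V' where "parabolic_ell \<Lambda>' a' b' U' V' L' \<xi>' \<eta>' c' \<phi>'"
    using associated_parabolic_ell assms(2,4) unfolding E' by blast
  then interpret P': parabolic_ell \<Lambda>' a' b' U' V' L' \<xi>' \<eta>' c' \<phi>' .
  define S where "S = {x + y | x y. x \<in> \<Lambda> \<and> y \<in> \<Lambda>'}"
  have S: "add_subgroup S" unfolding S_def by (rule add_subgroup_sum [OF P.subgroup P'.subgroup])
  have subS: "\<Lambda> \<subseteq> S" "\<Lambda>' \<subseteq> S"
    using add_subgroup_mem(1) [OF P.subgroup] add_subgroup_mem(1) [OF P'.subgroup]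
    unfolding S_def
    by (metis (mono_tags, lifting) add.right_neutral add.left_neutral mem_Collect_eq subsetI)+
  have QZ2_cases: thesis
    if "p \<in> carrier QZ2" "\<And>r t. p = (coset \<int> r, coset \<int> t) \<Longrightarrow> r \<in> \<rat> \<Longrightarrow> t \<in> \<rat> \<Longrightarrow> thesis" for p thesis
    using that by (auto simp: QZ2_def QZ_carrier)
  have commensurable_iff: "commensurable (\<Lambda>, \<phi>) (\<Lambda>', \<phi>') \<longleftrightarrow> rat_mult \<Lambda> = rat_mult \<Lambda>' \<and>
    (\<forall>r\<in>\<rat>. \<forall>t\<in>\<rat>. coset S (P.pt (U r + V t) t) = coset S (P'.pt (U' r + V' t) t))"
    by (auto simp: S_def [symmetric] P.\<phi>_coset P'.\<phi>_coset QZ2_def QZ_carrier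
        induced_id_coset [OF P.subgroup S subS(1)] induced_id_coset [OF P'.subgroup S subS(2)])
  have "\<Lambda> \<subseteq> \<Lambda>' \<and> transport \<Lambda> c c' f = induced_id \<Lambda> \<Lambda>' \<and>
      \<phi>' = compose (carrier QZ2) (transport \<Lambda> c c' f) \<phi>"
    if f: "triangular_isogeny E E' f" for f
  proof -
    obtain d N where d: "d \<noteq> 0" "N > 0" "\<And>z. f (coset L z) = coset L' (c * z / d)"
      "\<Lambda> \<subseteq> (*) d ` L'" "\<And>z. z \<in> (*) d ` L' \<Longrightarrow> of_nat N * z \<in> \<Lambda>"
      "\<And>r. r \<in> \<rat> \<Longrightarrow> \<xi>' (coset \<int> r) = coset L' (P.pt (U r) 0 / d)"
      "\<And>t. t \<in> \<rat> \<Longrightarrow> \<eta>' (coset \<int> t) = coset L' (P.pt (V t) t / d)"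
      by (rule P.triangular_isogenyE [OF f [unfolded E E'] P'.lattice_L]) blast
    have "d = c'"
      by (rule common_target_scaling [OF P.parabolic_coordinates_axioms P'.parabolic_coordinates_axioms
            P'.subgroup_L d(1) P'.c_nonzero d(2,5)])
         (use d(6,7) P'.\<xi>_coset P'.\<eta>_coset P'.\<Lambda>_image in auto)
    then have sub: "\<Lambda> \<subseteq> \<Lambda>'" and transport: "transport \<Lambda> c c' f = induced_id \<Lambda> \<Lambda>'"
      using d P.transport_eq [of f L' c'] P'.\<Lambda>_image P'.c_nonzero P'.subgroup_L by simp_all
    have "\<phi>' = compose (carrier QZ2) (induced_id \<Lambda> \<Lambda>') \<phi>"
    proof (rule extensionalityI [OF P'.\<phi>_extensional])
      show "compose (carrier QZ2) (induced_id \<Lambda> \<Lambda>') \<phi> \<in> extensional (carrier QZ2)"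
        by (simp add: compose_def)
      fix p assume p: "p \<in> carrier QZ2"
      then obtain r t where rt: "p = (coset \<int> r, coset \<int> t)" "r \<in> \<rat>" "t \<in> \<rat>"
        by (rule QZ2_cases)
      have c'_diff: "y - x \<in> \<Lambda>'" if "coset L' (x / c') = coset L' (y / c')" for x y
      proof -
        have "y / c' - x / c' \<in> L'" using that by (simp add: coset_eq_iff [symmetric] P'.subgroup_L)
        then have "c' * (y / c' - x / c') \<in> \<Lambda>'" unfolding P'.\<Lambda>_image by (rule imageI)
        then show ?thesis using P'.c_nonzero by (simp add: right_diff_distrib)
      qed
      have "P'.pt (U' r) 0 - P.pt (U r) 0 \<in> \<Lambda>'" "P'.pt (V' t) t - P.pt (V t) t \<in> \<Lambda>'"
        using c'_diff d(6,7) P'.\<xi>_coset P'.\<eta>_coset rt(2,3) \<open>d = c'\<close> by metis+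
      note add_subgroup_mem(2) [OF P'.subgroup this]
      moreover have "(P'.pt (U' r) 0 - P.pt (U r) 0) + (P'.pt (V' t) t - P.pt (V t) t)
          = P'.pt (U' r + V' t) t - P.pt (U r + V t) t"
        using par_pt_add [of a b "U r" 0 "V t" t] par_pt_add [of a' b' "U' r" 0 "V' t" t]
        by (simp add: algebra_simps)
      ultimately have "coset \<Lambda>' (P'.pt (U' r + V' t) t) = coset \<Lambda>' (P.pt (U r + V t) t)"
        by (simp add: coset_eq_iff P'.subgroup)
      then show "\<phi>' p = compose (carrier QZ2) (induced_id \<Lambda> \<Lambda>') \<phi> p"
        using p rt by (simp add: compose_def P.\<phi>_coset P'.\<phi>_coset
            induced_id_coset [OF P.subgroup P'.subgroup sub])
    qed
    with sub transport show ?thesis by simp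
  qed
  moreover have "commensurable (\<Lambda>, \<phi>) (\<Lambda>', \<phi>')"
    if E'': "triangular_ell E''" and f: "triangular_isogeny E E'' f" and f': "triangular_isogeny E' E'' f'"
    for E'' f f'
  proof -
    obtain L'' \<xi>'' \<eta>'' where E''_eq: "E'' = (L'', \<xi>'', \<eta>'')" by (metis prod_cases3)
    have L'': "lattice_in_complex L''" using E'' E''_eq by simp
    obtain d N where d: "d \<noteq> 0" "N > 0" "\<Lambda> \<subseteq> (*) d ` L''" "\<And>z. z \<in> (*) d ` L'' \<Longrightarrow> of_nat N * z \<in> \<Lambda>"
      "\<And>r. r \<in> \<rat> \<Longrightarrow> \<xi>'' (coset \<int> r) = coset L'' (P.pt (U r) 0 / d)"
      "\<And>t. t \<in> \<rat> \<Longrightarrow> \<eta>'' (coset \<int> t) = coset L'' (P.pt (V t) t / d)"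
      by (rule P.triangular_isogenyE [OF f [unfolded E E''_eq] L'']) blast
    obtain d' N' where d': "d' \<noteq> 0" "N' > 0" "\<Lambda>' \<subseteq> (*) d' ` L''"
      "\<And>z. z \<in> (*) d' ` L'' \<Longrightarrow> of_nat N' * z \<in> \<Lambda>'"
      "\<And>r. r \<in> \<rat> \<Longrightarrow> \<xi>'' (coset \<int> r) = coset L'' (P'.pt (U' r) 0 / d')"
      "\<And>t. t \<in> \<rat> \<Longrightarrow> \<eta>'' (coset \<int> t) = coset L'' (P'.pt (V' t) t / d')"
      by (rule P'.triangular_isogenyE [OF f' [unfolded E' E''_eq] L'']) blast
    note H'' = lattice_add_subgroup [OF L'']
    have "d = d'"
      by (rule common_target_scaling [OF P.parabolic_coordinates_axioms P'.parabolic_coordinates_axioms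
            H'' d(1) d'(1) d(2,4) d'(3)])
         (use d(5,6) d'(5,6) in auto)
    define M where "M = (*) d ` L''"
    have M: "add_subgroup M" unfolding M_def by (rule add_subgroup_mult_image [OF H''])
    have N: "\<And>z. z \<in> M \<Longrightarrow> of_nat N * z \<in> \<Lambda>" "\<And>z. z \<in> M \<Longrightarrow> of_nat N' * z \<in> \<Lambda>'"
      and sub: "\<Lambda> \<subseteq> M" "\<Lambda>' \<subseteq> M"
      using d(3,4) d'(3,4) \<open>d = d'\<close> by (auto simp: M_def)
    have M_diff: "x - y \<in> M" if "coset L'' (x / d) = coset L'' (y / d)" for x y
    proof -
      have "x / d - y / d \<in> L''" using that by (simp add: coset_eq_iff [symmetric] H'')
      then have "d * (x / d - y / d) \<in> M" unfolding M_def by (rule imageI)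
      then show ?thesis using d(1) by (simp add: right_diff_distrib)
    qed
    have "rat_mult \<Lambda> = rat_mult \<Lambda>'"
      using rat_mult_subset [OF d(2), of \<Lambda>' \<Lambda>] rat_mult_subset [OF d'(2), of \<Lambda> \<Lambda>'] N sub by blast
    moreover have "coset S (P.pt (U r + V t) t) = coset S (P'.pt (U' r + V' t) t)"
      if r: "r \<in> \<rat>" and t: "t \<in> \<rat>" for r t
    proof -
      \<comment> \<open>\<open>\<phi>\<close> and \<open>\<phi>'\<close> are only known to agree modulo \<open>M\<close>, and \<open>N M \<subseteq> S\<close>; but every argument is
        \<open>N\<close> times another one.\<close>
      define r1 t1 where "r1 = r / of_nat N" and "t1 = t / of_nat N"
      have rt1: "r1 \<in> \<rat>" "t1 \<in> \<rat>" "of_nat N * r1 = r" "of_nat N * t1 = t"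
        using r t d(2) by (simp_all add: r1_def t1_def)
      define z z' where "z = P.pt (U r1 + V t1) t1" and "z' = P'.pt (U' r1 + V' t1) t1"
      have "P.pt (U r1) 0 - P'.pt (U' r1) 0 \<in> M" "P.pt (V t1) t1 - P'.pt (V' t1) t1 \<in> M"
        using M_diff d(5,6) d'(5,6) rt1 \<open>d = d'\<close> by metis+
      note add_subgroup_mem(2) [OF M this]
      moreover have "(P.pt (U r1) 0 - P'.pt (U' r1) 0) + (P.pt (V t1) t1 - P'.pt (V' t1) t1) = z - z'"
        using par_pt_add [of a b "U r1" 0 "V t1" t1] par_pt_add [of a' b' "U' r1" 0 "V' t1" t1]
        by (simp add: z_def z'_def algebra_simps)
      ultimately have 1: "of_nat N * (z - z') \<in> S" using N(1) subS(1) by auto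
      have 2: "P.pt (U r + V t) t - of_nat N * z \<in> S" "P'.pt (U' r + V' t) t - of_nat N * z' \<in> S"
        using P.pt_nat_mult [OF rt1(1,2), of N] P'.pt_nat_mult [OF rt1(1,2), of N] subS
        unfolding rt1 z_def z'_def by blast+
      have "(P.pt (U r + V t) t - of_nat N * z) + of_nat N * (z - z')
          - (P'.pt (U' r + V' t) t - of_nat N * z') \<in> S"
        by (rule add_subgroup_mem(4) [OF S add_subgroup_mem(2) [OF S 2(1) 1] 2(2)])
      then show ?thesis by (simp add: coset_eq_iff S algebra_simps)
    qed
    ultimately show ?thesis unfolding commensurable_iff by blast
  qed
  moreover have "\<exists>E'' f f'. triangular_ell E'' \<and> triangular_isogeny E E'' f \<and> triangular_isogeny E' E'' f'"
    if "commensurable (\<Lambda>, \<phi>) (\<Lambda>', \<phi>')"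
  proof -
    have rat: "rat_mult \<Lambda> = rat_mult \<Lambda>'"
      and agree: "\<And>r t. r \<in> \<rat> \<Longrightarrow> t \<in> \<rat> \<Longrightarrow>
        coset S (P.pt (U r + V t) t) = coset S (P'.pt (U' r + V' t) t)"
      using that unfolding commensurable_iff by blast+
    obtain N where N: "N > 0" "\<And>z. z \<in> \<Lambda>' \<Longrightarrow> of_nat N * z \<in> \<Lambda>"
      using lattice_uniform_multiple [OF P'.lattice P.subgroup] rat_mult_multiple [OF P.subgroup]
        subset_rat_mult rat by (metis subsetD)
    obtain N' where N': "N' > 0" "\<And>z. z \<in> \<Lambda> \<Longrightarrow> of_nat N' * z \<in> \<Lambda>'"
      using lattice_uniform_multiple [OF P.lattice P'.subgroup] rat_mult_multiple [OF P'.subgroup]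
        subset_rat_mult rat by (metis subsetD)
    obtain d where d: "d > 0" "S = {of_int m * of_real d + of_int n * P.pt 0 1 | m n. True}"
      unfolding S_def
      by (rule parabolic_sum_lattice [OF P.parabolic_coordinates_axioms P'.parabolic_coordinates_axioms N])
    have "Im (cnj (of_real d) * P.pt 0 1) \<noteq> 0" using d by simp
    then have lattice_S: "lattice_in_complex S"
      unfolding lattice_in_complex_def conj_assoc [symmetric] independent_complex_iff using d(2) by blast
    define f f' where "f = quot_map L S ((*) c)" and "f' = quot_map L' S ((*) c')"
    define \<xi>'' \<eta>'' where "\<xi>'' = T_map f \<xi>" and "\<eta>'' = T_map f \<eta>"
    have cL: "(*) c ` L \<subseteq> S" "(*) c' ` L' \<subseteq> S"
      using subS P.\<Lambda>_image P'.\<Lambda>_image by simp_all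
    have f_coset: "f (coset L (z / c)) = coset S z" "f' (coset L' (z / c')) = coset S z" for z
      using P.c_nonzero P'.c_nonzero
      by (simp_all add: f_def f'_def quot_map_coset [OF P.subgroup_L S mult_additive cL(1)]
          quot_map_coset [OF P'.subgroup_L S mult_additive cL(2)])
    have mult_S: "of_nat N * z \<in> \<Lambda>" "of_nat N' * z \<in> \<Lambda>'" if "z \<in> S" for z
    proof -
      obtain x y where "z = x + y" "x \<in> \<Lambda>" "y \<in> \<Lambda>'" using \<open>z \<in> S\<close> unfolding S_def by blast
      then show "of_nat N * z \<in> \<Lambda>" "of_nat N' * z \<in> \<Lambda>'"
        using N(2) N'(2) add_subgroup_of_int_mult [OF P.subgroup, of x "int N"]
          add_subgroup_of_int_mult [OF P'.subgroup, of y "int N'"]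
          add_subgroup_mem(2) [OF P.subgroup] add_subgroup_mem(2) [OF P'.subgroup]
        by (simp_all add: distrib_left)
    qed
    have isogeny: "isogeny L S f" "isogeny L' S f'"
      unfolding f_def f'_def
      using quot_map_mult_isogeny [OF P.lattice_L lattice_S P.c_nonzero cL(1) N(1)]
        quot_map_mult_isogeny [OF P'.lattice_L lattice_S P'.c_nonzero cL(2) N'(1)]
        mult_S P.\<Lambda>_image P'.\<Lambda>_image by blast+
    have "triangular_ell (S, \<xi>'', \<eta>'')"
    proof (rule P.triangular_overlattice [OF d subS(1)])
      show "\<xi>'' \<in> TE S" "\<eta>'' \<in> TE S"
        unfolding \<xi>''_def \<eta>''_def f_def
        by (rule T_map_mult_TE [OF P.lattice_L lattice_S cL(1)], rule P.\<xi>_TE P.\<eta>_TE)+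
    qed (simp_all add: \<xi>''_def \<eta>''_def T_map_coset P.\<xi>_coset P.\<eta>_coset f_coset)
    moreover have "triangular_isogeny E (S, \<xi>'', \<eta>'') f"
      using isogeny by (simp add: E \<xi>''_def \<eta>''_def)
    moreover have "triangular_isogeny E' (S, \<xi>'', \<eta>'') f'"
    proof -
      have "T_map f' \<xi>' = \<xi>''"
      proof (rule quot_hom_eqI [of _ \<rat> \<int>])
        show "T_map f' \<xi>' (coset \<int> r) = \<xi>'' (coset \<int> r)" if "r \<in> \<rat>" for r
          using agree [OF that Rats_0] that
          by (simp add: \<xi>''_def T_map_coset P.\<xi>_coset P'.\<xi>_coset f_coset P.V_0 P'.V_0)
      qed (simp_all add: \<xi>''_def T_map_def compose_def QZ_def)
      moreover have "T_map f' \<eta>' = \<eta>''"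
      proof (rule quot_hom_eqI [of _ \<rat> \<int>])
        show "T_map f' \<eta>' (coset \<int> t) = \<eta>'' (coset \<int> t)" if "t \<in> \<rat>" for t
          using agree [OF Rats_0 that] that
          by (simp add: \<eta>''_def T_map_coset P.\<eta>_coset P'.\<eta>_coset f_coset P.U_0 P'.U_0)
      qed (simp_all add: \<eta>''_def T_map_def compose_def QZ_def)
      ultimately show ?thesis using isogeny by (simp add: E')
    qed
    ultimately show ?thesis by blast
  qed
  ultimately show ?thesis by blast
qed

end
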